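(* Let $K,R\ge 1$ be integers, $T>0$, $M_0>0$, and let $f\in C^{K+1}(\mathbb{R}\times[0,T])$ be real valued. Let $\phi:[0,T]\to[-M_0,M_0]$ be a solution of $\phi'(t)=f(\phi(t),t)$, $\phi(0)=\phi_0$, with $\phi\in C^{K(R+1)+1}([0,T])$. Let $\mathbf{a}^1,\dots,\mathbf{a}^R$ be a basis of the kernel $\mathcal{K}^R$ and assume that the $R\times R$ matrix $\boldsymbol{A}^{(0)}=(a^s_{0,r})_{s,r=1}^R$ is non-singular. Then there exist $\overline{\Delta t}>0$ and a real number $C$, independent of $\Delta t$, $r$, $j$ and $k$, such that the following holds. For every $\Delta t=T/N\le\overline{\Delta t}$ with $N=JR$, $J\ge1$ an integer, and for every numerical solution $(\phi^{(k)}_n)_{0\le k\le K,\,0\le n\le N}$ of the structural scheme with parameters $(K,R)$, exact initial value $\phi^{(0)}_0=\phi_0$ and $|\phi^{(0)}_n|\le M_0$ for all $n$, the errors $e^{(k)}_n=\phi^{(k)}(t_n)-\phi^{(k)}_n$ satisfy $$\big|e^{(k)}_{n+r}\big|\le C\,\Delta t^{K(R+1)}$$ for all $n=jR$ with $j\in\{0,\dots,J-1\}$, all $r\in\{1,\dots,R\}$ and all $k\in\{0,\dots,K\}$. That is, the scheme is of order $K(R+1)$ at any grid point and for any derivative.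
   Context: Structural equations. Let $M=(K+1)(R+1)$ and $\ell(k,r)=1+k(R+1)+r$ for $0\le k\le K$, $0\le r\le R$. Let $\mathcal{M}$ be the $M\times M$ matrix with entries $\mathcal{M}[m,\ell(k,r)]=\frac{(m-1)!}{(m-1-k)!}r^{m-1-k}$ if $m>k$ (with $0^0=1$) and $0$ otherwise. $\mathcal{K}^R\subset\mathbb{R}^M$ is the kernel of the $(M-R)\times M$ matrix formed by the first $M-R$ rows of $\mathcal{M}$; it has dimension $R$. Equivalently, $\mathbf{a}=(a_{k,r})\in\mathcal{K}^R$ iff $\sum_{k=0}^K\sum_{r=0}^R a_{k,r}\Delta t^k\pi^{(k)}(t_n+r\Delta t)=0$ for all polynomials $\pi$ of degree at most $K(R+1)$. Write $\mathbf{a}^s=(a^s_{k,r})_{k,r}$. The basis does not depend on $\Delta t$. Physical equations. Define $\mathrm{df}^{(0)}[z_0,t]=f(z_0,t)$ and, for $1\le k\le K-1$, $\mathrm{df}^{(k)}[z_0,\dots,z_k,t]=\partial_t\mathrm{df}^{(k-1)}[z_0,\dots,z_{k-1},t]+\sum_{j=0}^{k-1}\partial_{z_j}\mathrm{df}^{(k-1)}[z_0,\dots,z_{k-1},t]\,z_{j+1}$ (formal total time derivative), so that the exact solution satisfies $\phi^{(k)}(t)=\mathrm{df}^{(k-1)}[\phi(t),\dots,\phi^{(k-1)}(t),t]$. Structural scheme with parameters $(K,R)$. With $t_n=n\Delta t$, a numerical solution is a family of reals $(\phi^{(k)}_n)_{0\le k\le K,\,0\le n\le N}$ such that $\phi^{(k)}_n=\mathrm{df}^{(k-1)}[\phi^{(0)}_n,\dots,\phi^{(k-1)}_n,t_n]$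 for all $1\le k\le K$, $0\le n\le N$, and, for every block start $n=jR$, $0\le j\le J-1$, $\sum_{k=0}^K\sum_{r=0}^R a^s_{k,r}\Delta t^k\phi^{(k)}_{n+r}=0$ for all $s\in\{1,\dots,R\}$. *)

theory Defs
  imports "HOL-Analysis.Derivative" "Jordan_Normal_Form.Matrix_Kernel"
begin

text \<open>
  The class of \<open>m\<close> times continuously differentiable functions on a set \<open>S\<close>. Derivatives are taken
  within \<open>S\<close>, hence one-sided at boundary points. For \<open>S = {0..T}\<close> and \<open>S = UNIV \<times> {0..T}\<close> with
  \<open>T > 0\<close>, the sets it is used for, the derivative \<open>D x\<close> at a point of \<open>S\<close> is unique, and the
  functions \<open>\<lambda>x. D x b\<close> are the partial derivatives of \<open>g\<close>.
\<close>

fun Cm_on :: "nat \<Rightarrow> 'a::euclidean_space set \<Rightarrow> ('a \<Rightarrow> real) \<Rightarrow> bool" where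
  "Cm_on 0 S g \<longleftrightarrow> continuous_on S g"
| "Cm_on (Suc m) S g \<longleftrightarrow>
     (\<exists>D. (\<forall>x\<in>S. (g has_derivative D x) (at x within S)) \<and> (\<forall>b\<in>Basis. Cm_on m S (\<lambda>x. D x b)))"

definition nth_deriv_within :: "real set \<Rightarrow> nat \<Rightarrow> (real \<Rightarrow> real) \<Rightarrow> real \<Rightarrow> real" where
  "nth_deriv_within S k g = ((\<lambda>h t. vector_derivative h (at t within S)) ^^ k) g"

text \<open>
  The formal total time derivatives \<open>df\<^sup>(\<^sup>k\<^sup>)[z\<^sub>0, \<dots>, z\<^sub>k, t]\<close> of \<open>f\<close> on the strip with \<open>t \<in> {0..T}\<close>. The
  arguments \<open>z\<^sub>0, z\<^sub>1, \<dots>\<close> are given as a sequence, of which \<open>total_deriv f T k\<close> uses only the first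
  \<open>k + 1\<close> entries.
\<close>

primrec total_deriv :: "(real \<times> real \<Rightarrow> real) \<Rightarrow> real \<Rightarrow> nat \<Rightarrow> (nat \<Rightarrow> real) \<Rightarrow> real \<Rightarrow> real" where
  "total_deriv f T 0 = (\<lambda>z t. f (z 0, t))"
| "total_deriv f T (Suc k) = (\<lambda>z t.
     vector_derivative (\<lambda>s. total_deriv f T k z s) (at t within {0..T})
     + (\<Sum>j\<le>k. deriv (\<lambda>y. total_deriv f T k (z(j := y)) t) (z j) * z (Suc j)))"

text \<open>
  Rows and columns of matrices and entries of vectors are numbered from 0: the row \<open>i\<close> below
  is the row \<open>m = i + 1\<close> in the usual numbering, and \<open>col_index R k r\<close> is \<open>\<ell>(k,r) - 1\<close>. Thus the
  column \<open>c\<close> belongs to \<open>k = c div (R + 1)\<close> and \<open>r = c mod (R + 1)\<close>.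
\<close>

definition col_index :: "nat \<Rightarrow> nat \<Rightarrow> nat \<Rightarrow> nat" where
  "col_index R k r = k * (R + 1) + r"

definition structural_mat :: "nat \<Rightarrow> nat \<Rightarrow> real mat" where
  "structural_mat K R = mat ((K + 1) * (R + 1)) ((K + 1) * (R + 1)) (\<lambda>(i, c).
     let k = c div (R + 1); r = c mod (R + 1)
     in if k \<le> i then fact i / fact (i - k) * real r ^ (i - k) else 0)"

definition structural_submat :: "nat \<Rightarrow> nat \<Rightarrow> real mat" where
  "structural_submat K R = mat ((K + 1) * (R + 1) - R) ((K + 1) * (R + 1))
     (\<lambda>(i, c). structural_mat K R $$ (i, c))"

definition kernel_basis :: "nat \<Rightarrow> nat \<Rightarrow> (nat \<Rightarrow> real vec) \<Rightarrow> bool" where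
  "kernel_basis K R a \<longleftrightarrow>
     inj_on a {1..R} \<and> kernel.basis ((K + 1) * (R + 1)) (structural_submat K R) (a ` {1..R})"

definition A0_mat :: "nat \<Rightarrow> (nat \<Rightarrow> real vec) \<Rightarrow> real mat" where
  "A0_mat R a = mat R R (\<lambda>(s, r). a (s + 1) $ col_index R 0 (r + 1))"

text \<open>
  A numerical solution \<open>u\<close>, with \<open>u k n\<close> the approximation of the \<open>k\<close>-th derivative at
  time \<open>n * dt\<close>, computed on \<open>J\<close> blocks of \<open>R\<close> steps.
\<close>

definition structural_solution ::
  "(real \<times> real \<Rightarrow> real) \<Rightarrow> real \<Rightarrow> nat \<Rightarrow> nat \<Rightarrow> (nat \<Rightarrow> real vec) \<Rightarrow> nat \<Rightarrow> real
     \<Rightarrow> (nat \<Rightarrow> nat \<Rightarrow> real) \<Rightarrow> bool" where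
  "structural_solution f T K R a J dt u \<longleftrightarrow>
     (\<forall>k\<in>{1..K}. \<forall>n\<le>J * R. u k n = total_deriv f T (k - 1) (\<lambda>i. u i n) (real n * dt)) \<and>
     (\<forall>j<J. \<forall>s\<in>{1..R}.
        (\<Sum>k\<le>K. \<Sum>r\<le>R. a s $ col_index R k r * dt ^ k * u k (j * R + r)) = 0)"

end

theory Submission
  imports Defs "HOL-Analysis.Complex_Analysis_Basics"
begin

text \<open>
  On the bounded set of numerical values, the physical equations bound all errors \<open>e\<^sup>(\<^sup>k\<^sup>)\<close> by a
  constant times \<open>e\<^sup>(\<^sup>0\<^sup>)\<close>, since each \<open>df\<^sup>(\<^sup>k\<^sup>)\<close> is a polynomial in \<open>z\<^sub>1, \<dots>, z\<^sub>k\<close> whose coefficients are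
  partial derivatives of \<open>f\<close> at \<open>(z\<^sub>0, t)\<close>. The structural equations are exact for polynomials of
  degree at most \<open>D = K(R + 1)\<close>, so by Taylor expansion at the block start the exact solution satisfies them
  up to \<open>O(dt\<^bsup>D+1\<^esup>)\<close>. Exactness for constants gives
  \<open>\<Sum>\<^sub>r a\<^sup>s\<^sub>0\<^sub>,\<^sub>r = 0\<close>, hence inverting \<open>A\<^sup>(\<^sup>0\<^sup>)\<close> bounds the increments of \<open>e\<^sup>(\<^sup>0\<^sup>)\<close> inside a block by
  \<open>O(dt) (max \<bar>e\<^sup>(\<^sup>0\<^sup>)\<bar> + dt\<^bsup>D\<^esup>)\<close>, and a discrete Gronwall argument over the blocks concludes.
\<close>

section \<open>Classes of continuously differentiable functions\<close>

lemma Cm_on_imp_continuous_on: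
  assumes "Cm_on m S g"
  shows "continuous_on S g"
proof (cases m)
  case 0
  then show ?thesis
    using assms by simp
next
  case (Suc n)
  then obtain D where "\<forall>x\<in>S. (g has_derivative D x) (at x within S)"
    using assms by auto
  then show ?thesis
    by (intro has_derivative_continuous_on[of S g D]) simp
qed

lemma Cm_on_SucD: "Cm_on (Suc m) S g \<Longrightarrow> Cm_on m S g"
proof (induction m arbitrary: g)
  case 0
  then show ?case
    using Cm_on_imp_continuous_on[of "Suc 0" S g] by (simp only: Cm_on.simps(1))
next
  case (Suc m)
  then obtain D where D: "\<forall>x\<in>S. (g has_derivative D x) (at x within S)"
    "\<forall>b\<in>Basis. Cm_on (Suc m) S (\<lambda>x. D x b)"
    by auto
  then show ?case
    using Suc.IH by auto
qed

section \<open>Functions of finitely many jet variables and their derivatives\<close>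

text \<open>
  The class contains the functions \<open>total_deriv f T k\<close> and, unlike the set of all \<open>C\<^sup>m\<close> functions
  of \<open>(z, t)\<close>, it needs no topology on the space of sequences \<open>z\<close>.
\<close>

inductive jet_fun :: "real \<Rightarrow> nat \<Rightarrow> nat \<Rightarrow> ((nat \<Rightarrow> real) \<Rightarrow> real \<Rightarrow> real) \<Rightarrow> bool"
  for T m k where
  base: "Cm_on m (UNIV \<times> {0..T}) g \<Longrightarrow> jet_fun T m k (\<lambda>z t. g (z 0, t))"
| const: "jet_fun T m k (\<lambda>z t. c)"
| var: "j \<le> k \<Longrightarrow> jet_fun T m k (\<lambda>z t. z j)"
| add: "jet_fun T m k G \<Longrightarrow> jet_fun T m k H \<Longrightarrow> jet_fun T m k (\<lambda>z t. G z t + H z t)"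
| mult: "jet_fun T m k G \<Longrightarrow> jet_fun T m k H \<Longrightarrow> jet_fun T m k (\<lambda>z t. G z t * H z t)"

lemma jet_fun_mono: "jet_fun T m k G \<Longrightarrow> k \<le> k' \<Longrightarrow> jet_fun T m k' G"
  by (induction rule: jet_fun.induct) (auto intro: jet_fun.intros)

lemma jet_fun_SucD: "jet_fun T (Suc m) k G \<Longrightarrow> jet_fun T m k G"
  by (induction rule: jet_fun.induct) (auto intro: jet_fun.intros Cm_on_SucD simp del: Cm_on.simps)

lemma jet_fun_sum:
  assumes "finite I" "\<And>i. i \<in> I \<Longrightarrow> jet_fun T m k (G i)"
  shows "jet_fun T m k (\<lambda>z t. \<Sum>i\<in>I. G i z t)"
  using assms by (induction rule: finite_induct) (auto intro: jet_fun.intros)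

text \<open>The derivative of \<open>g\<close> is known only within \<open>S\<close>, so the chain
  rule needs the path to stay in \<open>S\<close>. This serves one-sided motion in time as well as
  two-sided motion in space.\<close>

lemma has_real_derivative_pair_compose:
  fixes g :: "real \<times> real \<Rightarrow> real"
  assumes g: "(g has_derivative D) (at (p s, q s) within S)"
    and p: "(p has_real_derivative p') (at s within U)"
    and q: "(q has_real_derivative q') (at s within U)"
    and S: "\<And>s. s \<in> U \<Longrightarrow> (p s, q s) \<in> S"
  shows "((\<lambda>s. g (p s, q s)) has_real_derivative p' * D (1, 0) + q' * D (0, 1)) (at s within U)"
proof -
  interpret D: bounded_linear D
    using g has_derivative_bounded_linear by blast
  have "((\<lambda>s. (p s, q s)) has_derivative (\<lambda>h. (p' * h, q' * h))) (at s within U)"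
    using p q by (auto intro!: has_derivative_Pair simp: has_field_derivative_def)
  moreover have "(g has_derivative D) (at (p s, q s) within (\<lambda>s. (p s, q s)) ` U)"
    by (rule has_derivative_subset[OF g]) (use S in auto)
  ultimately have "((\<lambda>s. g (p s, q s)) has_derivative (\<lambda>h. D (p' * h, q' * h))) (at s within U)"
    by (rule has_derivative_in_compose)
  moreover have "D (p' * h, q' * h) = (p' * D (1, 0) + q' * D (0, 1)) * h" for h
  proof -
    have "(p' * h, q' * h) = (p' * h) *\<^sub>R (1, 0) + (q' * h) *\<^sub>R (0, 1)"
      by simp
    then show ?thesis
      by (simp only: D.add D.scaleR) (simp add: algebra_simps)
  qed
  ultimately show ?thesis
    by (simp add: has_field_derivative_def)
qed

text \<open>The last clause says that the formal total derivative is a true one along curves whose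
  components are successive derivatives. It is a clause of its own because the existence of partial
  derivatives alone does not yield a chain rule.\<close>

definition jet_derivative ::
  "real \<Rightarrow> nat \<Rightarrow> ((nat \<Rightarrow> real) \<Rightarrow> real \<Rightarrow> real) \<Rightarrow> ((nat \<Rightarrow> real) \<Rightarrow> real \<Rightarrow> real) \<Rightarrow>
    (nat \<Rightarrow> (nat \<Rightarrow> real) \<Rightarrow> real \<Rightarrow> real) \<Rightarrow> bool" where
  "jet_derivative T k G Gt Gz \<longleftrightarrow> (\<forall>t\<in>{0..T}.
      (\<forall>z. ((\<lambda>s. G z s) has_real_derivative Gt z t) (at t within {0..T})) \<and>
      (\<forall>z. \<forall>j\<le>k. ((\<lambda>y. G (z(j := y)) t) has_real_derivative Gz j z t) (at (z j))) \<and>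
      (\<forall>Z. (\<forall>j\<le>k. ((\<lambda>s. Z s j) has_real_derivative Z t (Suc j)) (at t within {0..T})) \<longrightarrow>
        ((\<lambda>s. G (Z s) s) has_real_derivative Gt (Z t) t + (\<Sum>j\<le>k. Gz j (Z t) t * Z t (Suc j)))
          (at t within {0..T})))"

lemma jet_derivativeI:
  assumes "\<And>t z. t \<in> {0..T} \<Longrightarrow> ((\<lambda>s. G z s) has_real_derivative Gt z t) (at t within {0..T})"
    and "\<And>t z j. t \<in> {0..T} \<Longrightarrow> j \<le> k \<Longrightarrow>
      ((\<lambda>y. G (z(j := y)) t) has_real_derivative Gz j z t) (at (z j))"
    and "\<And>t Z. t \<in> {0..T} \<Longrightarrow>
      (\<And>j. j \<le> k \<Longrightarrow> ((\<lambda>s. Z s j) has_real_derivative Z t (Suc j)) (at t within {0..T})) \<Longrightarrow>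
      ((\<lambda>s. G (Z s) s) has_real_derivative Gt (Z t) t + (\<Sum>j\<le>k. Gz j (Z t) t * Z t (Suc j)))
        (at t within {0..T})"
  shows "jet_derivative T k G Gt Gz"
  unfolding jet_derivative_def by (intro ballI conjI allI impI assms) auto

lemma
  assumes "jet_derivative T k G Gt Gz" "t \<in> {0..T}"
  shows jet_derivative_time: "((\<lambda>s. G z s) has_real_derivative Gt z t) (at t within {0..T})"
    and jet_derivative_coord:
      "j \<le> k \<Longrightarrow> ((\<lambda>y. G (z(j := y)) t) has_real_derivative Gz j z t) (at (z j))"
    and jet_derivative_chain:
      "(\<And>j. j \<le> k \<Longrightarrow> ((\<lambda>s. Z s j) has_real_derivative Z t (Suc j)) (at t within {0..T})) \<Longrightarrow>
      ((\<lambda>s. G (Z s) s) has_real_derivative Gt (Z t) t + (\<Sum>j\<le>k. Gz j (Z t) t * Z t (Suc j)))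
        (at t within {0..T})"
  using bspec[OF assms(1)[unfolded jet_derivative_def] assms(2)] by simp_all

lemma jet_derivative_base:
  assumes D: "\<And>x. x \<in> UNIV \<times> {0..T} \<Longrightarrow> (g has_derivative D x) (at x within UNIV \<times> {0..T})"
  shows "jet_derivative T k (\<lambda>z t. g (z 0, t)) (\<lambda>z t. D (z 0, t) (0, 1))
    (\<lambda>j. if j = 0 then (\<lambda>z t. D (z 0, t) (1, 0)) else (\<lambda>z t. 0))" (is "jet_derivative _ _ _ ?Gt ?Gz")
proof (rule jet_derivativeI)
  let ?S = "UNIV \<times> {0..T} :: (real \<times> real) set"
  have sum: "(\<Sum>j\<le>k. ?Gz j z t * w j) = D (z 0, t) (1, 0) * w 0" for z t and w :: "nat \<Rightarrow> real"
    by (subst sum.remove[of _ 0]) (auto intro!: sum.neutral)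
  fix t assume t: "t \<in> {0..T}"
  show "((\<lambda>s. g (z 0, s)) has_real_derivative ?Gt z t) (at t within {0..T})" for z :: "nat \<Rightarrow> real"
    using has_real_derivative_pair_compose[of g "D (z 0, t)" "\<lambda>_. z 0" t "\<lambda>s. s" ?S 0 "{0..T}" 1] D[of "(z 0, t)"] t
    by simp
  \<comment> \<open>The coordinate \<open>z 0\<close> ranges over the whole line, so this derivative
    is two-sided; for \<open>j \<noteq> 0\<close> the function is constant in
    \<open>y\<close>.\<close>
  show "((\<lambda>y. g ((z(j := y)) 0, t)) has_real_derivative ?Gz j z t) (at (z j))" for z :: "nat \<Rightarrow> real" and j
    using has_real_derivative_pair_compose[of g "D (z 0, t)" "\<lambda>s. s" "z 0" "\<lambda>_. t" ?S 1 UNIV 0] D[of "(z 0, t)"] t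
    by simp
  show "((\<lambda>s. g (Z s 0, s)) has_real_derivative ?Gt (Z t) t + (\<Sum>j\<le>k. ?Gz j (Z t) t * Z t (Suc j)))
      (at t within {0..T})"
    if Z: "\<And>j. j \<le> k \<Longrightarrow> ((\<lambda>s. Z s j) has_real_derivative Z t (Suc j)) (at t within {0..T})" for Z
    using has_real_derivative_pair_compose[of g "D (Z t 0, t)" "\<lambda>s. Z s 0" t "\<lambda>s. s" ?S "Z t (Suc 0)" "{0..T}" 1]
      D[of "(Z t 0, t)"] t Z[of 0] unfolding sum
    by (simp add: mult.commute add.commute)
qed

lemma jet_derivative_const: "jet_derivative T k (\<lambda>z t. c) (\<lambda>z t. 0) (\<lambda>j z t. 0)"
  by (rule jet_derivativeI) auto

lemma jet_derivative_var:
  assumes "i \<le> k"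
  shows "jet_derivative T k (\<lambda>z t. z i) (\<lambda>z t. 0) (\<lambda>j z t. if j = i then 1 else 0)"
proof (rule jet_derivativeI)
  have "(\<Sum>j\<le>k. (if j = i then 1 else 0) * w j) = w i" for w :: "nat \<Rightarrow> real"
    using assms by (simp add: if_distrib if_distribR cong: if_cong)
  then show "((\<lambda>s. Z s i) has_real_derivative 0 + (\<Sum>j\<le>k. (if j = i then 1 else 0) * Z t (Suc j)))
      (at t within {0..T})"
    if "\<And>j. j \<le> k \<Longrightarrow> ((\<lambda>s. Z s j) has_real_derivative Z t (Suc j)) (at t within {0..T})" for Z t
    using that[OF assms] by simp
  show "((\<lambda>y. (z(j := y)) i) has_real_derivative (if j = i then 1 else 0)) (at (z j))" for z :: "nat \<Rightarrow> real" and j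
    by (cases "j = i") auto
qed auto

lemma jet_derivative_add:
  assumes "jet_derivative T k G Gt Gz" "jet_derivative T k H Ht Hz"
  shows "jet_derivative T k (\<lambda>z t. G z t + H z t) (\<lambda>z t. Gt z t + Ht z t) (\<lambda>j z t. Gz j z t + Hz j z t)"
proof (rule jet_derivativeI)
  fix t assume t: "t \<in> {0..T}"
  show "((\<lambda>s. G z s + H z s) has_real_derivative Gt z t + Ht z t) (at t within {0..T})" for z
    by (rule DERIV_add[OF assms[THEN jet_derivative_time, OF t]])
  show "((\<lambda>y. G (z(j := y)) t + H (z(j := y)) t) has_real_derivative Gz j z t + Hz j z t) (at (z j))"
    if "j \<le> k" for z j
    by (rule DERIV_add[OF assms[THEN jet_derivative_coord, OF t that]])
  show "((\<lambda>s. G (Z s) s + H (Z s) s) has_real_derivative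
      Gt (Z t) t + Ht (Z t) t + (\<Sum>j\<le>k. (Gz j (Z t) t + Hz j (Z t) t) * Z t (Suc j))) (at t within {0..T})"
    if Z: "\<And>j. j \<le> k \<Longrightarrow> ((\<lambda>s. Z s j) has_real_derivative Z t (Suc j)) (at t within {0..T})" for Z
    using DERIV_add[OF assms[THEN jet_derivative_chain, OF t, where Z = Z]] Z
    by (simp add: distrib_right sum.distrib add.assoc add.left_commute)
qed

lemma jet_derivative_mult:
  assumes "jet_derivative T k G Gt Gz" "jet_derivative T k H Ht Hz"
  shows "jet_derivative T k (\<lambda>z t. G z t * H z t) (\<lambda>z t. Gt z t * H z t + Ht z t * G z t)
    (\<lambda>j z t. Gz j z t * H z t + Hz j z t * G z t)"
proof (rule jet_derivativeI)
  fix t assume t: "t \<in> {0..T}"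
  show "((\<lambda>s. G z s * H z s) has_real_derivative Gt z t * H z t + Ht z t * G z t) (at t within {0..T})" for z
    by (rule DERIV_mult[OF assms[THEN jet_derivative_time, OF t]])
  show "((\<lambda>y. G (z(j := y)) t * H (z(j := y)) t) has_real_derivative Gz j z t * H z t + Hz j z t * G z t) (at (z j))"
    if "j \<le> k" for z j
    using DERIV_mult[OF assms[THEN jet_derivative_coord, OF t that, of z]] by simp
  show "((\<lambda>s. G (Z s) s * H (Z s) s) has_real_derivative Gt (Z t) t * H (Z t) t + Ht (Z t) t * G (Z t) t
      + (\<Sum>j\<le>k. (Gz j (Z t) t * H (Z t) t + Hz j (Z t) t * G (Z t) t) * Z t (Suc j))) (at t within {0..T})"
    if Z: "\<And>j. j \<le> k \<Longrightarrow> ((\<lambda>s. Z s j) has_real_derivative Z t (Suc j)) (at t within {0..T})" for Z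
  proof -
    have "Gt (Z t) t * H (Z t) t + Ht (Z t) t * G (Z t) t
      + (\<Sum>j\<le>k. (Gz j (Z t) t * H (Z t) t + Hz j (Z t) t * G (Z t) t) * Z t (Suc j))
      = (Gt (Z t) t + (\<Sum>j\<le>k. Gz j (Z t) t * Z t (Suc j))) * H (Z t) t
        + (Ht (Z t) t + (\<Sum>j\<le>k. Hz j (Z t) t * Z t (Suc j))) * G (Z t) t"
      by (simp add: sum.distrib sum_distrib_left algebra_simps)
    then show ?thesis
      using DERIV_mult[OF assms[THEN jet_derivative_chain, OF t, where Z = Z]] Z by simp
  qed
qed

text \<open>Rule induction shows that the class is closed under differentiation at the cost of one
  order of smoothness. The order is lost in the base case, where partial derivatives of
  \<open>g\<close> appear; the other cases follow the sum and product rules.\<close>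

lemma jet_fun_derivative:
  assumes "jet_fun T (Suc m) k G"
  shows "\<exists>Gt Gz. jet_fun T m k Gt \<and> (\<forall>j\<le>k. jet_fun T m k (Gz j)) \<and> jet_derivative T k G Gt Gz"
  using assms
proof (induction rule: jet_fun.induct)
  case (base g)
  let ?S = "UNIV \<times> {0..T} :: (real \<times> real) set"
  obtain D where D: "\<And>x. x \<in> ?S \<Longrightarrow> (g has_derivative D x) (at x within ?S)"
    and DC: "\<And>b. b \<in> Basis \<Longrightarrow> Cm_on m ?S (\<lambda>x. D x b)"
    using base by auto
  have "Cm_on m ?S (\<lambda>x. D x (1, 0))" "Cm_on m ?S (\<lambda>x. D x (0, 1))"
    by (auto intro!: DC simp: Basis_prod_def)
  note jet_fun.base[OF this(1)] jet_fun.base[OF this(2)]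
  with jet_derivative_base[OF D, of k] show ?case
    using jet_fun.const[of T m k 0] by (intro exI conjI) auto
next
  case (const c)
  show ?case
    by (intro exI conjI allI impI, (rule jet_fun.const jet_derivative_const)+)
next
  case (var i)
  have "jet_fun T m k (\<lambda>z t. if j = i then 1 else 0)" for j
    by (rule jet_fun.const)
  with jet_derivative_var[OF var] show ?case
    by (intro exI conjI allI impI) (auto intro: jet_fun.const)
next
  case (add G H)
  then obtain Gt Gz Ht Hz where GH:
    "jet_fun T m k Gt" "\<And>j. j \<le> k \<Longrightarrow> jet_fun T m k (Gz j)" "jet_derivative T k G Gt Gz"
    "jet_fun T m k Ht" "\<And>j. j \<le> k \<Longrightarrow> jet_fun T m k (Hz j)" "jet_derivative T k H Ht Hz"
    by metis
  have "\<forall>j\<le>k. jet_fun T m k (\<lambda>z t. Gz j z t + Hz j z t)"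
    by (simp add: jet_fun.add[OF GH(2,5)])
  with jet_fun.add[OF GH(1,4)] jet_derivative_add[OF GH(3,6)] show ?case
    by (intro exI conjI)
next
  case (mult G H)
  then obtain Gt Gz Ht Hz where GH:
    "jet_fun T m k Gt" "\<And>j. j \<le> k \<Longrightarrow> jet_fun T m k (Gz j)" "jet_derivative T k G Gt Gz"
    "jet_fun T m k Ht" "\<And>j. j \<le> k \<Longrightarrow> jet_fun T m k (Hz j)" "jet_derivative T k H Ht Hz"
    by metis
  \<comment> \<open>The product rule keeps undifferentiated factors, whose order has to be lowered
    to \<open>m\<close> as well.\<close>
  have "jet_fun T m k G" "jet_fun T m k H"
    using mult.hyps jet_fun_SucD by auto
  note products = jet_fun.mult[OF GH(1) this(2)] jet_fun.mult[OF GH(4) this(1)]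
    jet_fun.mult[OF GH(2) this(2)] jet_fun.mult[OF GH(5) this(1)]
  have "\<forall>j\<le>k. jet_fun T m k (\<lambda>z t. Gz j z t * H z t + Hz j z t * G z t)"
    by (simp add: jet_fun.add[OF products(3,4)])
  with jet_fun.add[OF products(1,2)] jet_derivative_mult[OF GH(3,6)] show ?case
    by (intro exI conjI)
qed

section \<open>Formal total derivatives as jet functions\<close>

lemma has_real_derivative_imp_vector_derivative_Icc:
  fixes h :: "real \<Rightarrow> real"
  assumes "a < b" "t \<in> {a..b}" "(h has_real_derivative d) (at t within {a..b})"
  shows "vector_derivative h (at t within {a..b}) = d"
  using assms by (simp add: vector_derivative_within_closed_interval has_real_derivative_iff_has_vector_derivative)

text \<open>Replaces the derivative operators in \<open>total_deriv\<close> by known derivatives of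
  \<open>G\<close>. Agreement with \<open>G\<close> at times in \<open>{0..T}\<close> suffices,
  since the time derivative is taken within that interval, where it is unique by
  \<open>0 < T\<close>, and the others at a fixed time in it.\<close>

lemma total_deriv_Suc_eq:
  assumes "0 < T" "t \<in> {0..T}"
    and eq: "\<And>z s. s \<in> {0..T} \<Longrightarrow> total_deriv f T k z s = G z s"
    and "((\<lambda>s. G z s) has_real_derivative Gt) (at t within {0..T})"
    and "\<And>j. j \<le> k \<Longrightarrow> ((\<lambda>y. G (z(j := y)) t) has_real_derivative Gz j) (at (z j))"
  shows "total_deriv f T (Suc k) z t = Gt + (\<Sum>j\<le>k. Gz j * z (Suc j))"
proof -
  have "((\<lambda>s. total_deriv f T k z s) has_real_derivative Gt) (at t within {0..T})"
    using assms(4) unfolding has_field_derivative_def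
    by (rule has_derivative_transform[OF assms(2), rotated]) (simp add: eq)
  then have "vector_derivative (\<lambda>s. total_deriv f T k z s) (at t within {0..T}) = Gt"
    using assms by (intro has_real_derivative_imp_vector_derivative_Icc) auto
  moreover have "deriv (\<lambda>y. total_deriv f T k (z(j := y)) t) (z j) = Gz j" if "j \<le> k" for j
    using assms(5)[OF that] assms(2) by (simp add: eq DERIV_imp_deriv)
  ultimately show ?thesis
    by simp
qed

text \<open>Each total derivative costs one order of smoothness of \<open>f\<close> and brings in
  one new variable, \<open>z (Suc k)\<close>. Hence the induction on \<open>k\<close> leaves
  \<open>m\<close> arbitrary and uses the hypothesis at \<open>Suc m\<close>.\<close>

lemma total_deriv_jet_fun:
  assumes "0 < T" "Cm_on (m + k) (UNIV \<times> {0..T}) f"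
  shows "\<exists>G. jet_fun T m k G \<and> (\<forall>t\<in>{0..T}. \<forall>z. total_deriv f T k z t = G z t)"
  using assms(2)
proof (induction k arbitrary: m)
  case 0
  then show ?case
    using jet_fun.base[of m T f 0] by auto
next
  case (Suc k)
  then obtain G where G: "jet_fun T (Suc m) k G" "\<And>t z. t \<in> {0..T} \<Longrightarrow> total_deriv f T k z t = G z t"
    by (metis add_Suc_shift)
  obtain Gt Gz where D: "jet_fun T m k Gt" "\<And>j. j \<le> k \<Longrightarrow> jet_fun T m k (Gz j)" "jet_derivative T k G Gt Gz"
    using jet_fun_derivative[OF G(1)] by metis
  have "jet_fun T m (Suc k) Gt" "\<And>j. j \<le> k \<Longrightarrow> jet_fun T m (Suc k) (Gz j)"
    using D(1,2) jet_fun_mono[of T m k _ "Suc k"] by auto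
  then have "jet_fun T m (Suc k) (\<lambda>z t. Gt z t + (\<Sum>j\<le>k. Gz j z t * z (Suc j)))"
    by (intro jet_fun.add jet_fun_sum jet_fun.mult jet_fun.var) auto
  moreover have "total_deriv f T (Suc k) z t = Gt z t + (\<Sum>j\<le>k. Gz j z t * z (Suc j))"
    if "t \<in> {0..T}" for z t
    using assms(1) that G(2) jet_derivative_time[OF D(3) that] jet_derivative_coord[OF D(3) that]
    by (rule total_deriv_Suc_eq)
  ultimately show ?case
    by blast
qed

text \<open>This is the last clause of \<open>jet_derivative\<close> for the function representing
  \<open>total_deriv f T k\<close>, with the resulting expression recognised as the next total
  derivative.\<close>

lemma total_deriv_chain:
  assumes "0 < T" "Cm_on (Suc k) (UNIV \<times> {0..T}) f" "t \<in> {0..T}"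
    and Z: "\<And>j. j \<le> k \<Longrightarrow> ((\<lambda>s. Z s j) has_real_derivative Z t (Suc j)) (at t within {0..T})"
  shows "((\<lambda>s. total_deriv f T k (Z s) s) has_real_derivative total_deriv f T (Suc k) (Z t) t)
    (at t within {0..T})"
proof -
  obtain G where G: "jet_fun T (Suc 0) k G" "\<And>t z. t \<in> {0..T} \<Longrightarrow> total_deriv f T k z t = G z t"
    using total_deriv_jet_fun[of T "Suc 0" k f] assms(1,2) by auto
  obtain Gt Gz where D: "jet_derivative T k G Gt Gz"
    using jet_fun_derivative[OF G(1)] by metis
  have "total_deriv f T (Suc k) (Z t) t = Gt (Z t) t + (\<Sum>j\<le>k. Gz j (Z t) t * Z t (Suc j))"
    using assms(1,3) G(2) jet_derivative_time[OF D assms(3)] jet_derivative_coord[OF D assms(3)]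
    by (rule total_deriv_Suc_eq)
  with jet_derivative_chain[OF D assms(3), of Z] Z
  have "((\<lambda>s. G (Z s) s) has_real_derivative total_deriv f T (Suc k) (Z t) t) (at t within {0..T})"
    by simp
  then show ?thesis
    unfolding has_field_derivative_def
    by (rule has_derivative_transform[OF assms(3), rotated]) (simp add: G(2))
qed

section \<open>Derivatives of the exact solution\<close>

lemma nth_deriv_within_Suc:
  "nth_deriv_within S (Suc k) g t = vector_derivative (nth_deriv_within S k g) (at t within S)"
  by (simp add: nth_deriv_within_def)

text \<open>Turns the nested existence statements of \<open>Cm_on\<close> into one sequence of
  functions. In dimension one the linear map \<open>D t\<close> is multiplication by
  \<open>D t 1\<close>.\<close>

lemma Cm_on_derivative_sequence:
  fixes g :: "real \<Rightarrow> real"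
  assumes "Cm_on m S g"
  shows "\<exists>G. G 0 = g \<and> (\<forall>i<m. \<forall>t\<in>S. (G i has_real_derivative G (Suc i) t) (at t within S)) \<and>
    continuous_on S (G m)"
  using assms
proof (induction m arbitrary: g)
  case 0
  then show ?case
    by (intro exI[of _ "\<lambda>_. g"]) simp
next
  case (Suc m)
  then obtain D where D: "\<forall>x\<in>S. (g has_derivative D x) (at x within S)" "Cm_on m S (\<lambda>x. D x 1)"
    by auto
  from Suc.IH[OF D(2)] obtain G where G: "G 0 = (\<lambda>x. D x 1)"
    "\<forall>i<m. \<forall>t\<in>S. (G i has_real_derivative G (Suc i) t) (at t within S)" "continuous_on S (G m)"
    by auto
  have g: "(g has_real_derivative G 0 t) (at t within S)" if "t \<in> S" for t
  proof -
    have d: "(g has_derivative D t) (at t within S)"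
      using D that by blast
    then interpret D: bounded_linear "D t"
      by (rule has_derivative_bounded_linear)
    have "D t h = D t 1 * h" for h
      using D.scaleR[of h 1] by (simp add: mult.commute)
    with d show ?thesis
      unfolding has_field_derivative_def G(1) by (metis (no_types, lifting) ext)
  qed
  show ?case
    using G g by (intro exI[of _ "case_nat g G"]) (auto split: nat.split simp: less_Suc_eq_0_disj)
qed

text \<open>Derivatives within a nondegenerate interval are unique, so by induction the iterated
  derivatives agree on \<open>{0..T}\<close> with the sequence that \<open>Cm_on\<close> provides,
  up to and including order \<open>m\<close>.\<close>

lemma Cm_on_nth_deriv_within:
  assumes "0 < T" "Cm_on m {0..T} g"
  shows "\<And>i t. i < m \<Longrightarrow> t \<in> {0..T} \<Longrightarrow>
      (nth_deriv_within {0..T} i g has_real_derivative nth_deriv_within {0..T} (Suc i) g t) (at t within {0..T})"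
    and "continuous_on {0..T} (nth_deriv_within {0..T} m g)"
proof -
  obtain G where G: "G 0 = g" "\<And>i t. i < m \<Longrightarrow> t \<in> {0..T} \<Longrightarrow> (G i has_real_derivative G (Suc i) t) (at t within {0..T})"
    "continuous_on {0..T} (G m)"
    using Cm_on_derivative_sequence[OF assms(2)] by blast
  have transfer: "(nth_deriv_within {0..T} i g has_real_derivative G (Suc i) t) (at t within {0..T})"
    if "i < m" "t \<in> {0..T}" "\<And>t. t \<in> {0..T} \<Longrightarrow> nth_deriv_within {0..T} i g t = G i t" for i t
    using G(2)[OF that(1,2)] unfolding has_field_derivative_def
    by (rule has_derivative_transform[OF that(2), rotated]) (simp add: that(3))
  have eq: "nth_deriv_within {0..T} i g t = G i t" if "i \<le> m" "t \<in> {0..T}" for i t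
    using that
  proof (induction i arbitrary: t)
    case 0
    then show ?case
      by (simp add: nth_deriv_within_def G)
  next
    case (Suc i)
    then show ?case
      unfolding nth_deriv_within_Suc
      by (intro has_real_derivative_imp_vector_derivative_Icc[OF assms(1)] transfer) auto
  qed
  show "(nth_deriv_within {0..T} i g has_real_derivative nth_deriv_within {0..T} (Suc i) g t) (at t within {0..T})"
    if "i < m" "t \<in> {0..T}" for i t
    using transfer[OF that] eq that by simp
  show "continuous_on {0..T} (nth_deriv_within {0..T} m g)"
    using G(3) eq by (subst continuous_on_cong[OF refl, of _ _ "G m"]) auto
qed

text \<open>The exact solution satisfies the physical equations: differentiating the equation of
  index \<open>k\<close> along the jet of \<open>\<phi>\<close> gives the next one by the chain
  rule, and the differential equation itself is the case \<open>k = 0\<close>.\<close>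

lemma nth_deriv_within_eq_total_deriv:
  assumes "0 < T" "Cm_on (K + 1) (UNIV \<times> {0..T}) f" "Cm_on m {0..T} \<phi>" "K \<le> m"
    and ode: "\<And>t. t \<in> {0..T} \<Longrightarrow> (\<phi> has_real_derivative f (\<phi> t, t)) (at t within {0..T})"
    and "k < K" "t \<in> {0..T}"
  shows "nth_deriv_within {0..T} (Suc k) \<phi> t = total_deriv f T k (\<lambda>i. nth_deriv_within {0..T} i \<phi> t) t"
  using assms(6,7)
proof (induction k arbitrary: t)
  case 0
  then show ?case
    using has_real_derivative_imp_vector_derivative_Icc[OF assms(1) 0(2) ode[OF 0(2)]]
    by (simp add: nth_deriv_within_def)
next
  case (Suc k)
  define Z where "Z = (\<lambda>s i. nth_deriv_within {0..T} i \<phi> s)"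
  have f: "Cm_on (Suc k) (UNIV \<times> {0..T}) f"
  proof -
    have "Cm_on (j + Suc k) (UNIV \<times> {0..T}) f \<Longrightarrow> ?thesis" for j
      by (induction j) (auto dest: Cm_on_SucD simp del: Cm_on.simps)
    then show ?thesis
      using assms(2) Suc.prems(1) le_add_diff_inverse2[of "Suc k" "K + 1"] by (metis less_imp_le_nat trans_le_add1)
  qed
  have "((\<lambda>s. total_deriv f T k (Z s) s) has_real_derivative total_deriv f T (Suc k) (Z t) t) (at t within {0..T})"
    using assms(4) Suc.prems
    by (intro total_deriv_chain[OF assms(1) f] ) (auto simp: Z_def intro!: Cm_on_nth_deriv_within(1)[OF assms(1,3)])
  then have "(nth_deriv_within {0..T} (Suc k) \<phi> has_real_derivative total_deriv f T (Suc k) (Z t) t) (at t within {0..T})"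
    unfolding has_field_derivative_def
    by (rule has_derivative_transform[OF Suc.prems(2), rotated]) (use Suc in \<open>simp add: Z_def\<close>)
  from has_real_derivative_imp_vector_derivative_Icc[OF assms(1) Suc.prems(2) this] show ?case
    by (simp add: nth_deriv_within_Suc[of _ "Suc k"] Z_def)
qed

section \<open>Bounds and Lipschitz estimates for the physical equations\<close>

lemma continuous_on_compact_abs_bound:
  fixes g :: "'a::metric_space \<Rightarrow> real"
  assumes "continuous_on S g" "compact S"
  shows "\<exists>C\<ge>0. \<forall>x\<in>S. \<bar>g x\<bar> \<le> C"
  using compact_imp_bounded[OF compact_continuous_image[OF assms]]
  by (auto simp: bounded_pos intro: less_imp_le)

text \<open>Only the base case needs compactness, and only that of the rectangle
  \<open>{-B..B} \<times> {0..T}\<close>; sums and products preserve boundedness.\<close>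

lemma jet_fun_bounded:
  assumes "jet_fun T m k G"
  shows "\<exists>C\<ge>0. \<forall>t\<in>{0..T}. \<forall>z. (\<forall>i\<le>k. \<bar>z i\<bar> \<le> B) \<longrightarrow> \<bar>G z t\<bar> \<le> C"
  using assms
proof (induction rule: jet_fun.induct)
  case (base g)
  have "continuous_on ({-B..B} \<times> {0..T}) g"
    using Cm_on_imp_continuous_on[OF base] by (rule continuous_on_subset) auto
  from continuous_on_compact_abs_bound[OF this] obtain C where
    "C \<ge> 0" "\<forall>x\<in>{-B..B} \<times> {0..T}. \<bar>g x\<bar> \<le> C"
    by (auto intro: compact_Times)
  then show ?case
    by (intro exI[of _ C]) (auto simp: abs_le_iff)
next
  case (const c)
  show ?case
    by (intro exI[of _ "\<bar>c\<bar>"]) simp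
next
  case (var j)
  then show ?case
    by (intro exI[of _ "\<bar>B\<bar>"]) (auto intro: order_trans)
next
  case (add G H)
  then obtain C D where "C \<ge> 0" "D \<ge> 0"
    "\<And>t z. t \<in> {0..T} \<Longrightarrow> \<forall>i\<le>k. \<bar>z i\<bar> \<le> B \<Longrightarrow> \<bar>G z t\<bar> \<le> C"
    "\<And>t z. t \<in> {0..T} \<Longrightarrow> \<forall>i\<le>k. \<bar>z i\<bar> \<le> B \<Longrightarrow> \<bar>H z t\<bar> \<le> D"
    by blast
  then show ?case
    by (intro exI[of _ "C + D"] conjI ballI allI impI)
      (auto intro!: order_trans[OF abs_triangle_ineq] add_mono)
next
  case (mult G H)
  then obtain C D where "C \<ge> 0" "D \<ge> 0"
    "\<And>t z. t \<in> {0..T} \<Longrightarrow> \<forall>i\<le>k. \<bar>z i\<bar> \<le> B \<Longrightarrow> \<bar>G z t\<bar> \<le> C"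
    "\<And>t z. t \<in> {0..T} \<Longrightarrow> \<forall>i\<le>k. \<bar>z i\<bar> \<le> B \<Longrightarrow> \<bar>H z t\<bar> \<le> D"
    by blast
  then show ?case
    by (intro exI[of _ "C * D"] conjI ballI allI impI)
      (auto simp: abs_mult intro!: mult_mono)
qed

text \<open>Mean value estimate in the first variable, with the partial derivative bounded by
  continuity on a compact rectangle.\<close>

lemma Cm_on_strip_Lipschitz:
  fixes T B :: real
  assumes "Cm_on (Suc m) (UNIV \<times> {0..T}) g"
  shows "\<exists>L\<ge>0. \<forall>t\<in>{0..T}. \<forall>x\<in>{-B..B}. \<forall>y\<in>{-B..B}. \<bar>g (x, t) - g (y, t)\<bar> \<le> L * \<bar>x - y\<bar>"
proof -
  let ?S = "UNIV \<times> {0..T} :: (real \<times> real) set"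
  obtain D where D: "\<And>x. x \<in> ?S \<Longrightarrow> (g has_derivative D x) (at x within ?S)"
    and DC: "\<And>b. b \<in> Basis \<Longrightarrow> Cm_on m ?S (\<lambda>x. D x b)"
    using assms by auto
  have "continuous_on ?S (\<lambda>x. D x (1, 0))"
    by (rule Cm_on_imp_continuous_on[OF DC]) (simp add: Basis_prod_def)
  then have "continuous_on ({-B..B} \<times> {0..T}) (\<lambda>x. D x (1, 0))"
    by (rule continuous_on_subset) auto
  from continuous_on_compact_abs_bound[OF this] obtain L where
    L: "L \<ge> 0" "\<forall>x\<in>{-B..B} \<times> {0..T}. \<bar>D x (1, 0)\<bar> \<le> L"
    by (auto intro: compact_Times)
  have "\<bar>g (x, t) - g (y, t)\<bar> \<le> L * \<bar>x - y\<bar>" if "t \<in> {0..T}" "x \<in> {-B..B}" "y \<in> {-B..B}" for t x y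
  proof -
    have "((\<lambda>y. g (y, t)) has_real_derivative D (y, t) (1, 0)) (at y within {-B..B})" for y
      using has_real_derivative_pair_compose[of g "D (y, t)" "\<lambda>s. s" y "\<lambda>_. t" ?S 1 "{-B..B}" 0] D[of "(y, t)"] that
      by simp
    from field_differentiable_bound[OF _ this, of L x y] show ?thesis
      using L that by auto
  qed
  then show ?thesis
    using L(1) by blast
qed

text \<open>A common bound \<open>d\<close> on the differences of the relevant coordinates takes the
  place of a norm on sequences. The bound \<open>B\<close> is essential for products, whose
  Lipschitz constant involves the size of the factors.\<close>

lemma jet_fun_Lipschitz:
  assumes "jet_fun T (Suc m) k G"
  shows "\<exists>L\<ge>0. \<forall>t\<in>{0..T}. \<forall>z w d. (\<forall>i\<le>k. \<bar>z i\<bar> \<le> B \<and> \<bar>w i\<bar> \<le> B \<and> \<bar>z i - w i\<bar> \<le> d) \<longrightarrow>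
    \<bar>G z t - G w t\<bar> \<le> L * d"
  using assms
proof (induction rule: jet_fun.induct)
  case (base g)
  obtain L where L: "L \<ge> 0"
    "\<And>t x y. t \<in> {0..T} \<Longrightarrow> x \<in> {-B..B} \<Longrightarrow> y \<in> {-B..B} \<Longrightarrow> \<bar>g (x, t) - g (y, t)\<bar> \<le> L * \<bar>x - y\<bar>"
    using Cm_on_strip_Lipschitz[OF base, of B] by blast
  have "\<bar>g (z 0, t) - g (w 0, t)\<bar> \<le> L * d"
    if "t \<in> {0..T}" "\<forall>i\<le>k. \<bar>z i\<bar> \<le> B \<and> \<bar>w i\<bar> \<le> B \<and> \<bar>z i - w i\<bar> \<le> d" for z w :: "nat \<Rightarrow> real" and t d
  proof -
    have zw: "\<bar>z 0\<bar> \<le> B" "\<bar>w 0\<bar> \<le> B" "\<bar>z 0 - w 0\<bar> \<le> d"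
      using that(2) by auto
    have "\<bar>g (z 0, t) - g (w 0, t)\<bar> \<le> L * \<bar>z 0 - w 0\<bar>"
      using zw by (intro L(2) that(1)) (auto simp: abs_le_iff)
    also have "\<dots> \<le> L * d"
      using zw L(1) by (intro mult_left_mono) auto
    finally show ?thesis .
  qed
  then show ?case
    using L(1) by blast
next
  case (const c)
  show ?case
    by (intro exI[of _ 0]) simp
next
  case (var j)
  then show ?case
    by (intro exI[of _ 1]) simp
next
  case (add G H)
  obtain C D where CD: "C \<ge> 0" "D \<ge> 0"
    "\<And>t z w d. t \<in> {0..T} \<Longrightarrow> \<forall>i\<le>k. \<bar>z i\<bar> \<le> B \<and> \<bar>w i\<bar> \<le> B \<and> \<bar>z i - w i\<bar> \<le> d \<Longrightarrow> \<bar>G z t - G w t\<bar> \<le> C * d"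
    "\<And>t z w d. t \<in> {0..T} \<Longrightarrow> \<forall>i\<le>k. \<bar>z i\<bar> \<le> B \<and> \<bar>w i\<bar> \<le> B \<and> \<bar>z i - w i\<bar> \<le> d \<Longrightarrow> \<bar>H z t - H w t\<bar> \<le> D * d"
    using add.IH by metis
  show ?case
  proof (intro exI[of _ "C + D"] conjI ballI allI impI)
    fix t z w d assume "t \<in> {0..T}" "\<forall>i\<le>k. \<bar>z i\<bar> \<le> B \<and> \<bar>w i\<bar> \<le> B \<and> \<bar>z i - w i\<bar> \<le> d"
    from CD(3)[OF this] CD(4)[OF this] show "\<bar>G z t + H z t - (G w t + H w t)\<bar> \<le> (C + D) * d"
      by (simp add: distrib_right)
  qed (use CD in auto)
next
  case (mult G H)
  obtain C D where CD: "C \<ge> 0" "D \<ge> 0"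
    "\<And>t z w d. t \<in> {0..T} \<Longrightarrow> \<forall>i\<le>k. \<bar>z i\<bar> \<le> B \<and> \<bar>w i\<bar> \<le> B \<and> \<bar>z i - w i\<bar> \<le> d \<Longrightarrow> \<bar>G z t - G w t\<bar> \<le> C * d"
    "\<And>t z w d. t \<in> {0..T} \<Longrightarrow> \<forall>i\<le>k. \<bar>z i\<bar> \<le> B \<and> \<bar>w i\<bar> \<le> B \<and> \<bar>z i - w i\<bar> \<le> d \<Longrightarrow> \<bar>H z t - H w t\<bar> \<le> D * d"
    using mult.IH by metis
  obtain P where P: "P \<ge> 0" "\<And>t z. t \<in> {0..T} \<Longrightarrow> \<forall>i\<le>k. \<bar>z i\<bar> \<le> B \<Longrightarrow> \<bar>G z t\<bar> \<le> P"
    using jet_fun_bounded[OF mult.hyps(1), of B] by blast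
  obtain Q where Q: "Q \<ge> 0" "\<And>t z. t \<in> {0..T} \<Longrightarrow> \<forall>i\<le>k. \<bar>z i\<bar> \<le> B \<Longrightarrow> \<bar>H z t\<bar> \<le> Q"
    using jet_fun_bounded[OF mult.hyps(2), of B] by blast
  show ?case
  proof (intro exI[of _ "P * D + Q * C"] conjI ballI allI impI)
    fix t z w d assume t: "t \<in> {0..T}" and zw: "\<forall>i\<le>k. \<bar>z i\<bar> \<le> B \<and> \<bar>w i\<bar> \<le> B \<and> \<bar>z i - w i\<bar> \<le> d"
    \<comment> \<open>Changing one factor at a time leaves each difference multiplied by a factor
      bounded by \<open>P\<close> or \<open>Q\<close>.\<close>
    have "G z t * H z t - G w t * H w t = G z t * (H z t - H w t) + H w t * (G z t - G w t)"
      by (simp add: algebra_simps)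
    also have "\<bar>\<dots>\<bar> \<le> \<bar>G z t\<bar> * \<bar>H z t - H w t\<bar> + \<bar>H w t\<bar> * \<bar>G z t - G w t\<bar>"
      by (rule order_trans[OF abs_triangle_ineq]) (simp add: abs_mult)
    also have "\<dots> \<le> P * (D * d) + Q * (C * d)"
      using t zw P Q CD(3)[OF t zw] CD(4)[OF t zw] by (intro add_mono mult_mono) auto
    finally show "\<bar>G z t * H z t - G w t * H w t\<bar> \<le> (P * D + Q * C) * d"
      by (simp add: algebra_simps)
  qed (use CD P Q in auto)
qed

text \<open>The physical equations determine all entries from \<open>z 0\<close>, and each is a
  bounded Lipschitz function of its predecessors on a box. The conclusion includes the size bounds
  because they supply the box for the next entry, while \<open>M\<close> controls only
  \<open>z 0\<close>.\<close>

lemma total_deriv_sequence_Lipschitz: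
  assumes "0 < T" "Cm_on (K + 1) (UNIV \<times> {0..T}) f" "k \<le> K"
  shows "\<exists>L\<ge>0. \<forall>t\<in>{0..T}. \<forall>z w. \<bar>z 0\<bar> \<le> M \<longrightarrow> \<bar>w 0\<bar> \<le> M \<longrightarrow>
    (\<forall>i<k. z (Suc i) = total_deriv f T i z t \<and> w (Suc i) = total_deriv f T i w t) \<longrightarrow>
    (\<forall>i\<le>k. \<bar>z i\<bar> \<le> L \<and> \<bar>w i\<bar> \<le> L \<and> \<bar>z i - w i\<bar> \<le> L * \<bar>z 0 - w 0\<bar>)"
  using assms(3)
proof (induction k)
  case 0
  \<comment> \<open>The constant must bound the entry itself and be at least 1 as a Lipschitz
    constant.\<close>
  have "\<bar>z - w\<bar> \<le> (\<bar>M\<bar> + 1) * \<bar>z - w\<bar>" for z w :: real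
    by (simp add: distrib_right)
  then show ?case
    by (intro exI[of _ "\<bar>M\<bar> + 1"]) auto
next
  case (Suc k)
  then obtain L where L: "L \<ge> 0" and
    IH: "\<And>t z w i. t \<in> {0..T} \<Longrightarrow> \<bar>z 0\<bar> \<le> M \<Longrightarrow> \<bar>w 0\<bar> \<le> M \<Longrightarrow>
    (\<forall>i<k. z (Suc i) = total_deriv f T i z t \<and> w (Suc i) = total_deriv f T i w t) \<Longrightarrow>
    (\<forall>i\<le>k. \<bar>z i\<bar> \<le> L \<and> \<bar>w i\<bar> \<le> L \<and> \<bar>z i - w i\<bar> \<le> L * \<bar>z 0 - w 0\<bar>)"
    using Suc_leD by metis
  have "K + 1 = Suc (K - k) + k"
    using Suc.prems by simp
  then obtain G where G: "jet_fun T (Suc (K - k)) k G" "\<And>t z. t \<in> {0..T} \<Longrightarrow> total_deriv f T k z t = G z t"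
    using total_deriv_jet_fun[OF assms(1), of "Suc (K - k)" k f] assms(2) by metis
  obtain C where C: "C \<ge> 0" "\<And>t z. t \<in> {0..T} \<Longrightarrow> \<forall>i\<le>k. \<bar>z i\<bar> \<le> L \<Longrightarrow> \<bar>G z t\<bar> \<le> C"
    using jet_fun_bounded[OF G(1), of L] by blast
  obtain D where D: "D \<ge> 0"
    "\<And>t z w d. t \<in> {0..T} \<Longrightarrow> \<forall>i\<le>k. \<bar>z i\<bar> \<le> L \<and> \<bar>w i\<bar> \<le> L \<and> \<bar>z i - w i\<bar> \<le> d \<Longrightarrow> \<bar>G z t - G w t\<bar> \<le> D * d"
    using jet_fun_Lipschitz[OF G(1), of L] by blast
  \<comment> \<open>The three terms pay for the earlier entries, the size of the new entry, and its
    variation, a composition of two Lipschitz bounds.\<close>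
  define L' where "L' = L + C + D * L"
  have L': "L \<le> L'" "C \<le> L'" "D * L \<le> L'" "0 \<le> L'"
    using L C(1) D(1) by (auto simp: L'_def)
  show ?case
  proof (intro exI[of _ L'] conjI[OF L'(4)] ballI allI impI)
    fix t z w i
    assume t: "t \<in> {0..T}" and 0: "\<bar>z 0\<bar> \<le> M" "\<bar>w 0\<bar> \<le> M" and
      eq: "\<forall>i<Suc k. z (Suc i) = total_deriv f T i z t \<and> w (Suc i) = total_deriv f T i w t"
      and i: "i \<le> Suc k"
    have zw: "\<forall>i\<le>k. \<bar>z i\<bar> \<le> L \<and> \<bar>w i\<bar> \<le> L \<and> \<bar>z i - w i\<bar> \<le> L * \<bar>z 0 - w 0\<bar>"
      using eq by (intro IH[of t z w] t 0) auto
    show "\<bar>z i\<bar> \<le> L' \<and> \<bar>w i\<bar> \<le> L' \<and> \<bar>z i - w i\<bar> \<le> L' * \<bar>z 0 - w 0\<bar>"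
    proof (cases "i \<le> k")
      case True
      have "L * \<bar>z 0 - w 0\<bar> \<le> L' * \<bar>z 0 - w 0\<bar>"
        using L' by (intro mult_right_mono) auto
      with zw True L' show ?thesis
        by (meson order_trans)
    next
      case False
      then have "z i = G z t" "w i = G w t"
        using eq i G(2)[OF t] by (auto simp: le_Suc_eq)
      moreover have "\<bar>G z t\<bar> \<le> C" "\<bar>G w t\<bar> \<le> C"
        using zw C(2)[OF t] by auto
      moreover have "\<bar>G z t - G w t\<bar> \<le> D * (L * \<bar>z 0 - w 0\<bar>)"
        by (rule D(2)[OF t zw])
      moreover have "D * (L * \<bar>z 0 - w 0\<bar>) \<le> L' * \<bar>z 0 - w 0\<bar>"
        using mult_right_mono[OF L'(3), of "\<bar>z 0 - w 0\<bar>"] by (simp add: mult.assoc)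
      ultimately show ?thesis
        using L' by (auto intro: order_trans)
    qed
  qed
qed

section \<open>Structural equations and their truncation error\<close>

lemma sum_structural_columns:
  "(\<Sum>c<(K + 1) * (R + 1). g c) = (\<Sum>k\<le>K. \<Sum>r\<le>R. g (col_index R k r))"
proof -
  have "(\<Sum>c<(K + 1) * (R + 1). g c) = (\<Sum>k<K + 1. sum g {k * (R + 1)..<k * (R + 1) + (R + 1)})"
    by (rule sum.nat_group[symmetric])
  also have "\<dots> = (\<Sum>k<K + 1. \<Sum>r<R + 1. g (col_index R k r))"
  proof (rule sum.cong[OF refl])
    fix k
    show "sum g {k * (R + 1)..<k * (R + 1) + (R + 1)} = (\<Sum>r<R + 1. g (col_index R k r))"
      by (rule sum.reindex_bij_witness[of _ "\<lambda>r. k * (R + 1) + r" "\<lambda>c. c - k * (R + 1)"])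
        (auto simp: col_index_def)
  qed
  finally show ?thesis
    by (simp add: lessThan_Suc_atMost)
qed

text \<open>Row \<open>i\<close> expresses exactness for the monomial x^i with block start 0 and
  unit step: the factor in the sum is the \<open>k\<close>-th derivative of x^i at
  \<open>r\<close>.\<close>

lemma kernel_basis_row:
  assumes "kernel_basis K R a" "s \<in> {1..R}" "i \<le> K * (R + 1)"
  shows "(\<Sum>k\<le>K. \<Sum>r\<le>R. a s $ col_index R k r *
    (if k \<le> i then fact i / fact (i - k) * real r ^ (i - k) else 0)) = 0"
proof -
  let ?A = "structural_submat K R"
  have A: "?A \<in> carrier_mat ((K + 1) * (R + 1) - R) ((K + 1) * (R + 1))"
    by (simp add: structural_submat_def)
  interpret kernel "(K + 1) * (R + 1) - R" "(K + 1) * (R + 1)" ?A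
    by unfold_locales (rule A)
  have "a s \<in> mat_kernel ?A"
    using assms(1,2) unfolding kernel_basis_def Ker.basis_def by auto
  then have a: "a s \<in> carrier_vec ((K + 1) * (R + 1))" "?A *\<^sub>v a s = 0\<^sub>v ((K + 1) * (R + 1) - R)"
    using mat_kernelD[OF A] by auto
  \<comment> \<open>The submatrix has \<open>K * (R + 1) + 1\<close> rows, so the zero-based index
    \<open>K * (R + 1)\<close> is its last row.\<close>
  have i: "i < (K + 1) * (R + 1) - R"
    using assms(3) by (simp add: algebra_simps)
  have "(?A *\<^sub>v a s) $ i = (\<Sum>c<(K + 1) * (R + 1). ?A $$ (i, c) * a s $ c)"
    using A a(1) i by (simp add: scalar_prod_def lessThan_atLeast0)
  also have "\<dots> = (\<Sum>k\<le>K. \<Sum>r\<le>R. ?A $$ (i, col_index R k r) * a s $ col_index R k r)"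
    by (rule sum_structural_columns)
  also have "\<dots> = (\<Sum>k\<le>K. \<Sum>r\<le>R. a s $ col_index R k r *
    (if k \<le> i then fact i / fact (i - k) * real r ^ (i - k) else 0))"
  proof (intro sum.cong refl)
    fix k r assume kr: "k \<in> {..K}" "r \<in> {..R}"
    have c: "col_index R k r < (K + 1) * (R + 1)"
    proof -
      have "k * (R + 1) \<le> K * (R + 1)"
        using kr by (intro mult_right_mono) auto
      then show ?thesis
        using kr by (simp add: col_index_def)
    qed
    have "col_index R k r div (R + 1) = k" "col_index R k r mod (R + 1) = r"
      using kr by (auto simp: col_index_def div_mult_self3 simp del: mult_Suc_right)
    then show "?A $$ (i, col_index R k r) * a s $ col_index R k r = a s $ col_index R k r *
      (if k \<le> i then fact i / fact (i - k) * real r ^ (i - k) else 0)"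
      using i c unfolding structural_submat_def structural_mat_def
      by (simp add: Let_def)
  qed
  finally show ?thesis
    using a(2) i by simp
qed

text \<open>Each \<open>F k\<close> is split into its Taylor polynomial at \<open>t\<close> and a
  remainder. The polynomial parts cancel by exactness; the remainder of \<open>F k\<close> has order
  \<open>D - k + 1\<close> in \<open>h\<close>, and the weight \<open>h ^ k\<close> raises every
  contribution to \<open>h ^ Suc D\<close>.\<close>

lemma structural_truncation_error:
  fixes F :: "nat \<Rightarrow> real \<Rightarrow> real" and c :: "nat \<Rightarrow> nat \<Rightarrow> real"
  assumes c: "\<And>i. i \<le> D \<Longrightarrow> (\<Sum>k\<le>K. \<Sum>r\<le>R. c k r *
      (if k \<le> i then fact i / fact (i - k) * real r ^ (i - k) else 0)) = 0"
    and F: "\<And>i t. i \<le> D \<Longrightarrow> t \<in> {0..T} \<Longrightarrow> (F i has_real_derivative F (Suc i) t) (at t within {0..T})"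
    and B: "\<And>t. t \<in> {0..T} \<Longrightarrow> \<bar>F (Suc D) t\<bar> \<le> B"
    and "K \<le> D" "0 \<le> h" "0 \<le> t" "t + real R * h \<le> T"
  shows "\<bar>\<Sum>k\<le>K. \<Sum>r\<le>R. c k r * h ^ k * F k (t + real r * h)\<bar>
    \<le> (\<Sum>k\<le>K. \<Sum>r\<le>R. \<bar>c k r\<bar> * (real R + 1) ^ Suc D) * B * h ^ Suc D"
proof -
  \<comment> \<open>The degree \<open>D - k\<close> makes all these polynomials derivatives of a
    single one, the Taylor polynomial of \<open>F 0\<close> of degree \<open>D\<close>.\<close>
  define P where "P = (\<lambda>k r. \<Sum>i\<le>D - k. F (k + i) t * (real r * h) ^ i / fact i)"
  have T: "t + real r * h \<in> {0..T}" if "r \<le> R" for r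
  proof -
    have "real r * h \<le> real R * h"
      using that assms by (intro mult_right_mono) auto
    then show ?thesis
      using assms by auto
  qed
  have B0: "B \<ge> 0"
    using B[OF T[of 0]] by auto
  have rem: "\<bar>F k (t + real r * h) - P k r\<bar> * h ^ k \<le> (real R + 1) ^ Suc D * B * h ^ Suc D"
    if k: "k \<le> K" and r: "r \<le> R" for k r
  proof -
    have kD: "k \<le> D"
      using k assms by simp
    have "\<bar>F k (t + real r * h) - P k r\<bar> \<le> B * \<bar>real r * h\<bar> ^ Suc (D - k) / fact (D - k)"
      using field_Taylor[of "{0..T}" "D - k" "\<lambda>i. F (k + i)" B t "t + real r * h"] F B kD T[OF r] T[of 0]
      by (simp add: P_def)
    also have "\<dots> \<le> B * \<bar>real r * h\<bar> ^ Suc (D - k) / 1"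
      using B0 by (intro divide_left_mono) auto
    also have "\<dots> = B * real r ^ Suc (D - k) * h ^ Suc (D - k)"
      using assms by (simp add: power_mult_distrib)
    also have "\<dots> \<le> B * (real R + 1) ^ Suc D * h ^ Suc (D - k)"
    proof -
      have "real r ^ Suc (D - k) \<le> (real R + 1) ^ Suc (D - k)"
        using r by (intro power_mono) auto
      \<comment> \<open>The base is at least 1, so the exponent can be raised to one that does not
        depend on \<open>k\<close>.\<close>
      also have "\<dots> \<le> (real R + 1) ^ Suc D"
        by (intro power_increasing) auto
      finally show ?thesis
        using B0 assms by (intro mult_right_mono mult_left_mono) auto
    qed
    finally have "\<bar>F k (t + real r * h) - P k r\<bar> * h ^ k \<le> B * (real R + 1) ^ Suc D * h ^ Suc (D - k) * h ^ k"
      using assms by (intro mult_right_mono) auto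
    also have "\<dots> = B * (real R + 1) ^ Suc D * h ^ (Suc (D - k) + k)"
      by (simp only: power_add mult.assoc)
    also have "Suc (D - k) + k = Suc D"
      using kD by simp
    finally show ?thesis
      by (simp add: mult.commute mult.left_commute)
  qed
  define q where "q = (\<lambda>i k r. if k \<le> i then fact i / fact (i - k) * real r ^ (i - k) else (0 :: real))"
  have P: "h ^ k * P k r = (\<Sum>i\<le>D. F i t * h ^ i / fact i * q i k r)" if "k \<le> K" for k r
  proof -
    have "(\<Sum>i\<le>D. F i t * h ^ i / fact i * q i k r) = (\<Sum>i\<in>{k..D}. F i t * h ^ i / fact i * q i k r)"
      by (rule sum.mono_neutral_right) (auto simp: q_def)
    also have "\<dots> = (\<Sum>i\<le>D - k. h ^ k * (F (k + i) t * (real r * h) ^ i / fact i))"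
      using that \<open>K \<le> D\<close>
      by (intro sum.reindex_bij_witness[of _ "\<lambda>i. k + i" "\<lambda>i. i - k"])
        (auto simp: q_def power_mult_distrib power_add[symmetric])
    finally show ?thesis
      by (simp add: P_def sum_distrib_left)
  qed
  \<comment> \<open>After the sum over \<open>i\<close> is moved outside, the inner double sum is
    the exactness condition for degree \<open>i\<close> and vanishes.\<close>
  have "(\<Sum>k\<le>K. \<Sum>r\<le>R. c k r * h ^ k * P k r)
      = (\<Sum>k\<le>K. \<Sum>r\<le>R. \<Sum>i\<le>D. (F i t * h ^ i / fact i) * (c k r * q i k r))"
    by (intro sum.cong refl) (simp add: mult.assoc P sum_distrib_left mult.left_commute)
  also have "\<dots> = (\<Sum>k\<le>K. \<Sum>i\<le>D. \<Sum>r\<le>R. (F i t * h ^ i / fact i) * (c k r * q i k r))"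
    by (intro sum.cong refl sum.swap)
  also have "\<dots> = (\<Sum>i\<le>D. \<Sum>k\<le>K. \<Sum>r\<le>R. (F i t * h ^ i / fact i) * (c k r * q i k r))"
    by (rule sum.swap)
  also have "\<dots> = (\<Sum>i\<le>D. (F i t * h ^ i / fact i) * (\<Sum>k\<le>K. \<Sum>r\<le>R. c k r * q i k r))"
    by (simp add: sum_distrib_left)
  also have "\<dots> = 0"
    using c by (simp add: q_def)
  finally have "(\<Sum>k\<le>K. \<Sum>r\<le>R. c k r * h ^ k * F k (t + real r * h))
      = (\<Sum>k\<le>K. \<Sum>r\<le>R. c k r * ((F k (t + real r * h) - P k r) * h ^ k))"
    by (simp add: algebra_simps sum_subtractf)
  also have "\<bar>\<dots>\<bar> \<le> (\<Sum>k\<le>K. \<Sum>r\<le>R. \<bar>c k r * ((F k (t + real r * h) - P k r) * h ^ k)\<bar>)"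
    by (rule order_trans[OF sum_abs]) (intro sum_mono sum_abs)
  also have "\<dots> \<le> (\<Sum>k\<le>K. \<Sum>r\<le>R. \<bar>c k r\<bar> * ((real R + 1) ^ Suc D * B * h ^ Suc D))"
  proof (intro sum_mono)
    fix k r assume "k \<in> {..K}" "r \<in> {..R}"
    then show "\<bar>c k r * ((F k (t + real r * h) - P k r) * h ^ k)\<bar> \<le> \<bar>c k r\<bar> * ((real R + 1) ^ Suc D * B * h ^ Suc D)"
      using rem[of k r] assms by (simp add: abs_mult mult_left_mono)
  qed
  also have "\<dots> = (\<Sum>k\<le>K. \<Sum>r\<le>R. \<bar>c k r\<bar> * (real R + 1) ^ Suc D) * B * h ^ Suc D"
    by (simp only: sum_distrib_right mult.assoc)
  finally show ?thesis .
qed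

section \<open>Inversion of the matrix of the zeroth-order coefficients\<close>

lemma A0_mat_inverse_bound:
  assumes "invertible_mat (A0_mat R a)"
  shows "\<exists>Q\<ge>0. \<forall>x \<delta>. (\<forall>s\<in>{1..R}. \<bar>\<Sum>r\<in>{1..R}. a s $ col_index R 0 r * x r\<bar> \<le> \<delta>) \<longrightarrow>
    (\<forall>r\<in>{1..R}. \<bar>x r\<bar> \<le> Q * \<delta>)"
proof -
  let ?A = "A0_mat R a"
  have A: "?A \<in> carrier_mat R R"
    by (simp add: A0_mat_def)
  obtain B where B: "inverts_mat ?A B" "inverts_mat B ?A"
    using assms unfolding invertible_mat_def by blast
  \<comment> \<open>The size of \<open>B\<close> is not given; comparing column numbers in the two
    inverse identities yields it.\<close>
  have dim: "B \<in> carrier_mat R R"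
  proof -
    have "dim_col B = R"
      using arg_cong[OF B(1)[unfolded inverts_mat_def], of dim_col] A by simp
    moreover have "dim_row B = R"
      using arg_cong[OF B(2)[unfolded inverts_mat_def], of dim_col] A by simp
    ultimately show ?thesis
      by auto
  qed
  have BA: "B * ?A = 1\<^sub>m R"
    using B(2) dim unfolding inverts_mat_def by simp
  \<comment> \<open>The sum of the absolute values of all entries of the inverse dominates each of
    its row sums.\<close>
  define Q where "Q = (\<Sum>i<R. \<Sum>j<R. \<bar>B $$ (i, j)\<bar>)"
  have "\<bar>x r\<bar> \<le> Q * \<delta>"
    if x: "\<forall>s\<in>{1..R}. \<bar>\<Sum>r\<in>{1..R}. a s $ col_index R 0 r * x r\<bar> \<le> \<delta>" and r: "r \<in> {1..R}"
    for x :: "nat \<Rightarrow> real" and \<delta> r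
  proof -
    define y where "y = (\<lambda>s. \<Sum>r\<in>{1..R}. a s $ col_index R 0 r * x r)"
    have y: "\<bar>y s\<bar> \<le> \<delta>" if "s \<in> {1..R}" for s
      using x that by (simp add: y_def)
    define X where "X = vec R (\<lambda>i. x (i + 1))"
    define Y where "Y = vec R (\<lambda>i. y (i + 1))"
    have shift: "(\<Sum>q<R. g (Suc q)) = (\<Sum>q\<in>{1..R}. g q)" for g :: "nat \<Rightarrow> real"
      by (rule sum.reindex_bij_witness[of _ "\<lambda>q. q - 1" Suc]) auto
    have "?A *\<^sub>v X = Y"
    proof (rule eq_vecI)
      fix i assume "i < dim_vec Y"
      then have i: "i < R"
        by (simp add: Y_def)
      then have "(?A *\<^sub>v X) $ i = (\<Sum>q<R. a (Suc i) $ col_index R 0 (Suc q) * x (Suc q))"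
        by (simp add: A0_mat_def X_def scalar_prod_def lessThan_atLeast0)
      also have "\<dots> = (\<Sum>q\<in>{1..R}. a (Suc i) $ col_index R 0 q * x q)"
        by (rule shift)
      also have "\<dots> = Y $ i"
        using i by (simp add: Y_def y_def)
      finally show "(?A *\<^sub>v X) $ i = Y $ i" .
    qed (simp add: A0_mat_def Y_def)
    then have "B *\<^sub>v Y = (B * ?A) *\<^sub>v X"
      using assoc_mult_mat_vec[OF dim A, of X] by (simp add: X_def)
    also have "\<dots> = X"
      unfolding BA by (simp add: X_def)
    finally have BY: "B *\<^sub>v Y = X" .
    have i: "r - 1 < R"
      using r by auto
    have "x r = X $ (r - 1)"
      using r i by (simp add: X_def)
    also have "\<dots> = (\<Sum>j<R. B $$ (r - 1, j) * y (Suc j))"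
      unfolding BY[symmetric] using dim i by (simp add: Y_def scalar_prod_def lessThan_atLeast0)
    also have "\<bar>\<dots>\<bar> \<le> (\<Sum>j<R. \<bar>B $$ (r - 1, j)\<bar> * \<delta>)"
      by (rule order_trans[OF sum_abs], intro sum_mono) (use y in \<open>simp add: abs_mult mult_left_mono\<close>)
    also have "\<dots> = (\<Sum>j<R. \<bar>B $$ (r - 1, j)\<bar>) * \<delta>"
      by (simp add: sum_distrib_right)
    also have "\<dots> \<le> Q * \<delta>"
    proof (rule mult_right_mono)
      show "(\<Sum>j<R. \<bar>B $$ (r - 1, j)\<bar>) \<le> Q"
        unfolding Q_def using i by (intro member_le_sum[of "r - 1" _ "\<lambda>i. \<Sum>j<R. \<bar>B $$ (i, j)\<bar>"]) (auto intro: sum_nonneg)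
      show "0 \<le> \<delta>"
        using y[OF r] by linarith
    qed
    finally show ?thesis .
  qed
  moreover have "Q \<ge> 0"
    by (auto simp: Q_def intro!: sum_nonneg)
  ultimately show ?thesis
    by blast
qed

section \<open>Error propagation within and across blocks\<close>

text \<open>The scheme is implicit: the increment bound involves the maximum \<open>E\<close> over
  the whole block, including unknown values. Since \<open>q \<le> 1 / 2\<close>, half of
  \<open>E\<close> absorbs the term \<open>q * E\<close>, which bounds \<open>E\<close> by the value
  at the block start.\<close>

lemma block_error_growth:
  fixes x :: "nat \<Rightarrow> real"
  assumes step: "\<And>E r. (\<And>r. r \<le> R \<Longrightarrow> \<bar>x r\<bar> \<le> E) \<Longrightarrow> r \<in> {1..R} \<Longrightarrow> \<bar>x r - x 0\<bar> \<le> q * (E + \<delta>)"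
    and "0 \<le> q" "q \<le> 1 / 2" "0 \<le> \<delta>" "r \<le> R"
  shows "\<bar>x r\<bar> \<le> (1 + 2 * q) * \<bar>x 0\<bar> + 2 * q * \<delta>"
proof -
  define E where "E = Max ((\<lambda>r. \<bar>x r\<bar>) ` {..R})"
  have E: "\<bar>x r\<bar> \<le> E" if "r \<le> R" for r
    using that by (auto simp: E_def)
  have inc: "\<bar>x r\<bar> \<le> \<bar>x 0\<bar> + q * (E + \<delta>)" if "r \<le> R" for r
  proof (cases "r = 0")
    case True
    then show ?thesis
      using E[of 0] assms by simp
  next
    case False
    then show ?thesis
      using step[OF E, of r] that by simp
  qed
  have "E \<in> (\<lambda>r. \<bar>x r\<bar>) ` {..R}"
    unfolding E_def by (rule Max_in) auto
  then have "E \<le> \<bar>x 0\<bar> + q * (E + \<delta>)"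
    using inc by auto
  moreover have "q * E \<le> 1 / 2 * E" "q * \<delta> \<le> 1 / 2 * \<delta>"
    using mult_right_mono[OF assms(3), of E] mult_right_mono[OF assms(3), of \<delta>] E[of 0] assms(4) by auto
  ultimately have "E + \<delta> \<le> 2 * \<bar>x 0\<bar> + 2 * \<delta>"
    by (simp add: distrib_left)
  then have "q * (E + \<delta>) \<le> q * (2 * \<bar>x 0\<bar> + 2 * \<delta>)"
    using assms by (intro mult_left_mono) auto
  with inc[OF \<open>r \<le> R\<close>] show ?thesis
    by (simp add: algebra_simps)
qed

text \<open>The recursion says that \<open>b j + \<delta>\<close> grows at most by the factor
  \<open>1 + p\<close> per step, starting from \<open>\<delta>\<close>.\<close>

lemma discrete_Gronwall:
  fixes b :: "nat \<Rightarrow> real"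
  assumes "b 0 = 0" "0 \<le> p" "\<And>j. j < J \<Longrightarrow> b (Suc j) \<le> (1 + p) * b j + p * \<delta>" "j \<le> J"
  shows "b j \<le> ((1 + p) ^ j - 1) * \<delta>"
  using assms(4)
proof (induction j)
  case 0
  then show ?case
    using assms by simp
next
  case (Suc j)
  have "b (Suc j) \<le> (1 + p) * b j + p * \<delta>"
    using Suc assms by simp
  also have "\<dots> \<le> (1 + p) * (((1 + p) ^ j - 1) * \<delta>) + p * \<delta>"
    using Suc assms by (intro add_right_mono mult_left_mono) auto
  finally show ?case
    by (simp add: algebra_simps)
qed

text \<open>Exactness for constants: in row 0 only the columns with \<open>k = 0\<close> survive,
  all with entry 1 because \<open>0 ^ 0 = 1\<close>.\<close>

lemma kernel_basis_sum_A0_row: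
  assumes "kernel_basis K R a" "s \<in> {1..R}"
  shows "(\<Sum>r\<le>R. a s $ col_index R 0 r) = 0"
proof -
  have "(\<Sum>k\<le>K. \<Sum>r\<le>R. a s $ col_index R k r *
      (if k \<le> 0 then fact 0 / fact (0 - k) * real r ^ (0 - k) else 0)) = 0"
    by (rule kernel_basis_row[OF assms]) simp
  also have "(\<Sum>k\<le>K. \<Sum>r\<le>R. a s $ col_index R k r *
      (if k \<le> 0 then fact 0 / fact (0 - k) * real r ^ (0 - k) else 0))
    = (\<Sum>k\<in>{0}. \<Sum>r\<le>R. a s $ col_index R k r *
      (if k \<le> 0 then fact 0 / fact (0 - k) * real r ^ (0 - k) else 0))"
    by (rule sum.mono_neutral_right) auto
  finally show ?thesis
    by simp
qed

text \<open>Isolating the terms with \<open>k = 0\<close> turns the structural equations into a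
  linear system for the increments \<open>e 0 r - e 0 0\<close>. Its right-hand side consists of the
  residual, at most \<open>\<tau>\<close>, and of the terms with \<open>k \<ge> 1\<close>, each
  carrying a factor \<open>h\<close>.\<close>

lemma structural_block_step:
  fixes e :: "nat \<Rightarrow> nat \<Rightarrow> real"
  assumes "kernel_basis K R a" "0 \<le> h" "h \<le> 1" "0 \<le> L" "0 \<le> Q"
    and Q: "\<forall>x \<delta>. (\<forall>s\<in>{1..R}. \<bar>\<Sum>r\<in>{1..R}. a s $ col_index R 0 r * x r\<bar> \<le> \<delta>) \<longrightarrow>
      (\<forall>r\<in>{1..R}. \<bar>x r\<bar> \<le> Q * \<delta>)"
    and lip: "\<And>k r. k \<le> K \<Longrightarrow> r \<le> R \<Longrightarrow> \<bar>e k r\<bar> \<le> L * \<bar>e 0 r\<bar>"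
    and tau: "\<And>s. s \<in> {1..R} \<Longrightarrow> \<bar>\<Sum>k\<le>K. \<Sum>r\<le>R. a s $ col_index R k r * h ^ k * e k r\<bar> \<le> \<tau>"
    and S: "S = (\<Sum>s\<in>{1..R}. \<Sum>k\<le>K. \<Sum>r\<le>R. \<bar>a s $ col_index R k r\<bar>)"
    and E: "\<And>r. r \<le> R \<Longrightarrow> \<bar>e 0 r\<bar> \<le> E" and r: "r \<in> {1..R}"
  shows "\<bar>e 0 r - e 0 0\<bar> \<le> Q * (\<tau> + S * L * h * E)"
\<comment> \<open>The increments are the vector \<open>x\<close> in the inverse bound, so it remains
  to bound each row of the system.\<close>
proof (rule Q[THEN spec[of _ "\<lambda>r. e 0 r - e 0 0"], THEN spec, THEN mp, THEN bspec, OF _ r], rule ballI)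
  fix s assume s: "s \<in> {1..R}"
  let ?a = "\<lambda>k r. a s $ col_index R k r"
  define high where "high = (\<Sum>k\<in>{1..K}. \<Sum>r\<le>R. ?a k r * h ^ k * e k r)"
  have E0: "0 \<le> E"
    using E[of 0] by linarith
  have "(\<Sum>r\<in>{1..R}. ?a 0 r * (e 0 r - e 0 0)) = (\<Sum>r\<le>R. ?a 0 r * (e 0 r - e 0 0))"
    by (rule sum.mono_neutral_left) (auto simp: Suc_le_eq)
  \<comment> \<open>The value at the block start is multiplied by a row sum, which is zero.\<close>
  also have "\<dots> = (\<Sum>r\<le>R. ?a 0 r * e 0 r) - (\<Sum>r\<le>R. ?a 0 r) * e 0 0"
    by (simp add: right_diff_distrib sum_subtractf sum_distrib_right)
  also have "\<dots> = (\<Sum>r\<le>R. ?a 0 r * e 0 r)"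
    using kernel_basis_sum_A0_row[OF assms(1) s] by simp
  also have "\<dots> = (\<Sum>k\<le>K. \<Sum>r\<le>R. ?a k r * h ^ k * e k r) - high"
  proof -
    have "{..K} = insert 0 {1..K}"
      by auto
    then show ?thesis
      by (simp add: high_def)
  qed
  finally have "\<bar>\<Sum>r\<in>{1..R}. ?a 0 r * (e 0 r - e 0 0)\<bar> \<le> \<tau> + \<bar>high\<bar>"
    using tau[OF s] by linarith
  also have "\<bar>high\<bar> \<le> (\<Sum>k\<in>{1..K}. \<Sum>r\<le>R. \<bar>?a k r * h ^ k * e k r\<bar>)"
    unfolding high_def by (rule order_trans[OF sum_abs]) (intro sum_mono sum_abs)
  also have "\<dots> \<le> (\<Sum>k\<in>{1..K}. \<Sum>r\<le>R. \<bar>?a k r\<bar> * (L * h * E))"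
  proof (intro sum_mono)
    fix k r assume kr: "k \<in> {1..K}" "r \<in> {..R}"
    have "\<bar>e k r\<bar> \<le> L * E"
      using lip[of k r] E[of r] kr assms(4) by (auto intro: order_trans mult_left_mono)
    \<comment> \<open>This rests on \<open>k \<ge> 1\<close> together with
      \<open>h \<le> 1\<close>.\<close>
    moreover have "h ^ k \<le> h"
      using power_decreasing[of 1 k h] kr assms by simp
    ultimately have "h ^ k * \<bar>e k r\<bar> \<le> h * (L * E)"
      using assms by (intro mult_mono) auto
    then show "\<bar>?a k r * h ^ k * e k r\<bar> \<le> \<bar>?a k r\<bar> * (L * h * E)"
      using assms by (simp add: abs_mult mult.assoc mult_left_mono mult.left_commute[of L h])
  qed
  also have "\<dots> = (\<Sum>k\<in>{1..K}. \<Sum>r\<le>R. \<bar>?a k r\<bar>) * (L * h * E)"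
    by (simp add: sum_distrib_right)
  also have "\<dots> \<le> S * (L * h * E)"
  proof (rule mult_right_mono)
    have "(\<Sum>k\<in>{1..K}. \<Sum>r\<le>R. \<bar>?a k r\<bar>) \<le> (\<Sum>k\<le>K. \<Sum>r\<le>R. \<bar>?a k r\<bar>)"
      by (rule sum_mono2) (auto intro: sum_nonneg)
    also have "\<dots> \<le> S"
      unfolding S by (rule member_le_sum[of s _ "\<lambda>s. \<Sum>k\<le>K. \<Sum>r\<le>R. \<bar>a s $ col_index R k r\<bar>", OF s])
        (auto intro: sum_nonneg)
    finally show "(\<Sum>k\<in>{1..K}. \<Sum>r\<le>R. \<bar>?a k r\<bar>) \<le> S" .
  qed (use assms E0 in auto)
  finally show "\<bar>\<Sum>r\<in>{1..R}. ?a 0 r * (e 0 r - e 0 0)\<bar> \<le> \<tau> + S * L * h * E"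
    by (simp add: mult.assoc)
qed

section \<open>Convergence at all grid points and for all derivatives\<close>

theorem theorem8p5:
  fixes K R :: nat and T M0 \<phi>0 :: real
    and f :: "real \<times> real \<Rightarrow> real" and \<phi> :: "real \<Rightarrow> real"
    and a :: "nat \<Rightarrow> real vec"
  assumes "K \<ge> 1" and "R \<ge> 1" and "T > 0" and "M0 > 0"
    and "Cm_on (K + 1) (UNIV \<times> {0..T}) f"
    and "\<phi> \<in> {0..T} \<rightarrow> {-M0..M0}"
    and "\<And>t. t \<in> {0..T} \<Longrightarrow> (\<phi> has_real_derivative f (\<phi> t, t)) (at t within {0..T})"
    and "\<phi> 0 = \<phi>0"
    and "Cm_on (K * (R + 1) + 1) {0..T} \<phi>"
    and "kernel_basis K R a"
    and "invertible_mat (A0_mat R a)"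
  shows "\<exists>dt_max>0. \<exists>C. \<forall>J dt u.
    J \<ge> 1 \<longrightarrow> dt = T / real (J * R) \<longrightarrow> dt \<le> dt_max \<longrightarrow>
    structural_solution f T K R a J dt u \<longrightarrow>
    u 0 0 = \<phi>0 \<longrightarrow> (\<forall>n\<le>J * R. \<bar>u 0 n\<bar> \<le> M0) \<longrightarrow>
    (\<forall>j<J. \<forall>r\<in>{1..R}. \<forall>k\<le>K.
      \<bar>nth_deriv_within {0..T} k \<phi> (real (j * R + r) * dt) - u k (j * R + r)\<bar>
        \<le> C * dt ^ (K * (R + 1)))"
proof -
  define D where "D = K * (R + 1)"
  define \<Phi> where "\<Phi> = (\<lambda>k. nth_deriv_within {0..T} k \<phi>)"
  have KD: "K \<le> D"
    by (simp add: D_def)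
  have C\<phi>: "Cm_on (Suc D) {0..T} \<phi>"
    using assms(9) by (simp add: D_def del: Cm_on.simps)
  have \<Phi>: "(\<Phi> i has_real_derivative \<Phi> (Suc i) t) (at t within {0..T})"
    if "i \<le> D" "t \<in> {0..T}" for i t
    unfolding \<Phi>_def by (rule Cm_on_nth_deriv_within(1)[OF assms(3) C\<phi>]) (use that in auto)
  obtain B where B: "B \<ge> 0" "\<And>t. t \<in> {0..T} \<Longrightarrow> \<bar>\<Phi> (Suc D) t\<bar> \<le> B"
    using continuous_on_compact_abs_bound[OF Cm_on_nth_deriv_within(2)[OF assms(3) C\<phi>]]
    by (auto simp: \<Phi>_def)
  obtain L where L: "L \<ge> 0" and Lip: "\<forall>t\<in>{0..T}. \<forall>z w. \<bar>z 0\<bar> \<le> M0 \<longrightarrow> \<bar>w 0\<bar> \<le> M0 \<longrightarrow>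
    (\<forall>i<K. z (Suc i) = total_deriv f T i z t \<and> w (Suc i) = total_deriv f T i w t) \<longrightarrow>
    (\<forall>i\<le>K. \<bar>z i\<bar> \<le> L \<and> \<bar>w i\<bar> \<le> L \<and> \<bar>z i - w i\<bar> \<le> L * \<bar>z 0 - w 0\<bar>)"
    using total_deriv_sequence_Lipschitz[OF assms(3,5) order_refl, of M0] by (elim exE conjE)
  have lip: "\<bar>z i - w i\<bar> \<le> L * \<bar>z 0 - w 0\<bar>"
    if "t \<in> {0..T}" "\<bar>z 0\<bar> \<le> M0" "\<bar>w 0\<bar> \<le> M0"
      "\<forall>i<K. z (Suc i) = total_deriv f T i z t \<and> w (Suc i) = total_deriv f T i w t" "i \<le> K" for t z w i
    using bspec[OF Lip that(1), THEN spec[of _ z], THEN spec[of _ w], THEN mp, OF that(2), THEN mp, OF that(3),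
      THEN mp, OF that(4), THEN spec, THEN mp, OF that(5)]
    by (elim conjE)
  obtain Q where Q0: "Q \<ge> 0" and
    Q: "\<forall>x \<delta>. (\<forall>s\<in>{1..R}. \<bar>\<Sum>r\<in>{1..R}. a s $ col_index R 0 r * x r\<bar> \<le> \<delta>) \<longrightarrow>
      (\<forall>r\<in>{1..R}. \<bar>x r\<bar> \<le> Q * \<delta>)"
    using A0_mat_inverse_bound[OF assms(11)] by (elim exE conjE)
  \<comment> \<open>The truncation constant of the equation with index \<open>s\<close>; the sum
    over \<open>s\<close> then serves all equations at once.\<close>
  define W where "W = (\<lambda>s. (\<Sum>k\<le>K. \<Sum>r\<le>R. \<bar>a s $ col_index R k r\<bar> * (real R + 1) ^ Suc D) * B)"
  define C\<tau> where "C\<tau> = (\<Sum>s\<in>{1..R}. W s)"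
  have W: "0 \<le> W s" for s
    unfolding W_def using B(1) by (intro mult_nonneg_nonneg sum_nonneg) auto
  then have C\<tau>: "0 \<le> C\<tau>" "\<And>s. s \<in> {1..R} \<Longrightarrow> W s \<le> C\<tau>"
    by (auto simp: C\<tau>_def intro!: sum_nonneg member_le_sum)
  define S where "S = (\<Sum>s\<in>{1..R}. \<Sum>k\<le>K. \<Sum>r\<le>R. \<bar>a s $ col_index R k r\<bar>)"
  have S: "0 \<le> S"
    by (auto simp: S_def intro!: sum_nonneg)
  \<comment> \<open>Up to the summand 1, this is the rate in the increment bound of a block. The
    summand makes \<open>C\<close> positive, so that \<open>1 / (2 * C)\<close> is a valid step
    bound.\<close>
  define C where "C = Q * (C\<tau> + S * L) + 1"
  have C: "0 < C"
    using Q0 C\<tau>(1) S L by (auto simp: C_def intro!: add_nonneg_pos)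
  \<comment> \<open>The bound \<open>dt \<le> 1\<close> gives \<open>dt ^ k \<le> dt\<close> for
    \<open>k \<ge> 1\<close>, and \<open>dt \<le> 1 / (2 * C)\<close> gives the absorption condition
    \<open>q \<le> 1 / 2\<close>. In the constant, \<open>exp (2 * C * T)\<close> comes from the
    Gronwall bound and \<open>L\<close> from passing from \<open>e 0\<close> to
    \<open>e k\<close>.\<close>
  have "\<bar>\<Phi> k (real (j * R + r) * dt) - u k (j * R + r)\<bar> \<le> L * exp (2 * C * T) * dt ^ D"
    if J: "J \<ge> 1" and dt: "dt = T / real (J * R)" "dt \<le> min 1 (1 / (2 * C))"
      and sol: "structural_solution f T K R a J dt u" and u0: "u 0 0 = \<phi>0" and uM: "\<forall>n\<le>J * R. \<bar>u 0 n\<bar> \<le> M0"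
      and j: "j < J" and r: "r \<in> {1..R}" and k: "k \<le> K" for J dt u j r k
  proof -
    define e where "e = (\<lambda>k n. \<Phi> k (real n * dt) - u k n)"
    have dt0: "0 < dt"
      using dt(1) assms(2,3) J by simp
    have JRdt: "real (J * R) * dt = T"
      using dt(1) assms(2) J by simp
    have grid: "real n * dt \<in> {0..T}" if "n \<le> J * R" for n
      using mult_right_mono[of "real n" "real (J * R)" dt] that dt0 JRdt by (simp del: of_nat_mult)
    have le: "j * R + r \<le> J * R" if "j < J" "r \<le> R" for j r
      using mult_right_mono[of "Suc j" J R] that by simp
    have e_lip: "\<bar>e k n\<bar> \<le> L * \<bar>e 0 n\<bar>" if "k \<le> K" "n \<le> J * R" for k n
      unfolding e_def
    proof (rule lip[OF grid[OF that(2)] _ _ _ that(1), of "\<lambda>k. \<Phi> k (real n * dt)" "\<lambda>k. u k n"])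
      show "\<bar>\<Phi> 0 (real n * dt)\<bar> \<le> M0"
        using funcset_mem[OF assms(6) grid[OF that(2)]] by (auto simp: \<Phi>_def nth_deriv_within_def)
      show "\<bar>u 0 n\<bar> \<le> M0"
        using uM that by simp
      show "\<forall>i<K. \<Phi> (Suc i) (real n * dt) = total_deriv f T i (\<lambda>k. \<Phi> k (real n * dt)) (real n * dt) \<and>
         u (Suc i) n = total_deriv f T i (\<lambda>k. u k n) (real n * dt)"
      proof (intro allI impI conjI)
        fix i assume i: "i < K"
        show "\<Phi> (Suc i) (real n * dt) = total_deriv f T i (\<lambda>k. \<Phi> k (real n * dt)) (real n * dt)"
          unfolding \<Phi>_def
          by (rule nth_deriv_within_eq_total_deriv[OF assms(3,5) C\<phi> _ assms(7) i grid[OF that(2)]]) (use KD in simp)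
        have "\<forall>k\<in>{1..K}. \<forall>n\<le>J * R. u k n = total_deriv f T (k - 1) (\<lambda>i. u i n) (real n * dt)"
          using sol unfolding structural_solution_def by blast
        then show "u (Suc i) n = total_deriv f T i (\<lambda>k. u k n) (real n * dt)"
          using i that(2) by auto
      qed
    qed
    define q where "q = C * dt"
    have q: "0 \<le> q" "q \<le> 1 / 2"
      using dt(2) dt0 C by (auto simp: q_def field_simps)
    have block: "\<bar>e 0 (j * R + r)\<bar> \<le> (1 + 2 * q) * \<bar>e 0 (j * R)\<bar> + 2 * q * dt ^ D"
      if j: "j < J" and "r \<le> R" for j r
    proof -
      \<comment> \<open>The numerical solution satisfies the structural equations exactly, so the
        residual of the error is that of the exact solution, namely its truncation error.\<close>
      have tau: "\<bar>\<Sum>k\<le>K. \<Sum>r\<le>R. a s $ col_index R k r * dt ^ k * e k (j * R + r)\<bar> \<le> C\<tau> * dt ^ Suc D"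
        if s: "s \<in> {1..R}" for s
      proof -
        have "(\<Sum>k\<le>K. \<Sum>r\<le>R. a s $ col_index R k r * dt ^ k * u k (j * R + r)) = 0"
          using sol s j unfolding structural_solution_def by blast
        then have "(\<Sum>k\<le>K. \<Sum>r\<le>R. a s $ col_index R k r * dt ^ k * e k (j * R + r))
          = (\<Sum>k\<le>K. \<Sum>r\<le>R. a s $ col_index R k r * dt ^ k * \<Phi> k (real (j * R) * dt + real r * dt))"
          by (simp add: e_def right_diff_distrib sum_subtractf distrib_right)
        also have "\<bar>\<dots>\<bar> \<le> W s * dt ^ Suc D"
          unfolding W_def
        proof (rule structural_truncation_error[OF _ \<Phi> B(2) KD])
          show "(\<Sum>k\<le>K. \<Sum>r\<le>R. a s $ col_index R k r *
            (if k \<le> i then fact i / fact (i - k) * real r ^ (i - k) else 0)) = 0" if "i \<le> D" for i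
            using kernel_basis_row[OF assms(10) s] that by (simp add: D_def)
          show "real (j * R) * dt + real R * dt \<le> T"
            using grid[OF le[OF j order_refl]] by (simp add: distrib_right)
        qed (use dt0 in auto)
        also have "\<dots> \<le> C\<tau> * dt ^ Suc D"
          using C\<tau>(2)[OF s] dt0 by (intro mult_right_mono) auto
        finally show ?thesis .
      qed
      have "\<bar>e 0 (j * R + r) - e 0 (j * R + 0)\<bar> \<le> q * (E + dt ^ D)"
        if E: "\<And>r. r \<le> R \<Longrightarrow> \<bar>e 0 (j * R + r)\<bar> \<le> E" and r: "r \<in> {1..R}" for E r
      proof -
        have E0: "0 \<le> E"
          using E[of 0] by linarith
        have "\<bar>e 0 (j * R + r) - e 0 (j * R + 0)\<bar> \<le> Q * (C\<tau> * dt ^ Suc D + S * L * dt * E)"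
          by (rule structural_block_step[where e = "\<lambda>k r. e k (j * R + r)", OF assms(10) _ _ L Q0 Q _ tau S_def E r])
            (use dt dt0 e_lip le[OF j] in auto)
        \<comment> \<open>Adding the nonnegative cross terms gives the product form that the block
          growth bound expects, with \<open>dt ^ D\<close> as its \<open>\<delta>\<close>.\<close>
        also have "\<dots> \<le> Q * ((C\<tau> + S * L) * dt * (E + dt ^ D))"
        proof (rule mult_left_mono[OF _ Q0])
          have "0 \<le> C\<tau> * dt * E + S * L * dt * dt ^ D"
            using C\<tau>(1) S L E0 dt0 by auto
          then show "C\<tau> * dt ^ Suc D + S * L * dt * E \<le> (C\<tau> + S * L) * dt * (E + dt ^ D)"
            by (simp add: algebra_simps)
        qed
        also have "\<dots> \<le> q * (E + dt ^ D)"
        proof -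
          have "0 \<le> dt * (E + dt ^ D)"
            using dt0 E0 by auto
          then show ?thesis
            by (simp add: q_def C_def algebra_simps)
        qed
        finally show ?thesis .
      qed
      from block_error_growth[where x = "\<lambda>r. e 0 (j * R + r)", OF this q _ \<open>r \<le> R\<close>] show ?thesis
        using dt0 by simp
    qed
    \<comment> \<open>The Gronwall bound runs over block starts only; the last node of a block is
      the start of the next, and the initial error is zero.\<close>
    have "\<bar>e 0 (j * R)\<bar> \<le> ((1 + 2 * q) ^ j - 1) * dt ^ D"
    proof (rule discrete_Gronwall[where J = J])
      show "\<bar>e 0 (0 * R)\<bar> = 0"
        using u0 assms(8) by (simp add: e_def \<Phi>_def nth_deriv_within_def)
      show "\<bar>e 0 (Suc i * R)\<bar> \<le> (1 + 2 * q) * \<bar>e 0 (i * R)\<bar> + 2 * q * dt ^ D" if "i < J" for i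
        using block[OF that order_refl] by (simp add: add.commute)
    qed (use q j in auto)
    \<comment> \<open>A point inside block \<open>j\<close> costs one more block step, hence the
      exponent \<open>Suc j\<close> below.\<close>
    then have "(1 + 2 * q) * \<bar>e 0 (j * R)\<bar> \<le> (1 + 2 * q) * (((1 + 2 * q) ^ j - 1) * dt ^ D)"
      using q by (intro mult_left_mono) auto
    with block[OF j, of r] r have "\<bar>e 0 (j * R + r)\<bar> \<le> ((1 + 2 * q) ^ Suc j - 1) * dt ^ D"
      by (simp add: algebra_simps)
    also have "\<dots> \<le> exp (2 * C * T) * dt ^ D"
    proof (rule mult_right_mono)
      have "(1 + 2 * q) ^ Suc j \<le> exp (2 * q) ^ Suc j"
        using q by (intro power_mono exp_ge_add_one_self) auto
      also have "\<dots> = exp (real (Suc j) * (2 * q))"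
        by (rule exp_of_nat_mult[symmetric])
      also have "\<dots> \<le> exp (2 * C * T)"
      proof -
        \<comment> \<open>By \<open>R \<ge> 1\<close>, the number of block steps is at most the
          number of time steps, so their total rate is at most \<open>2 * C * T\<close>.\<close>
        have "real (Suc j) \<le> real (J * R)"
          using j assms(2) mult_le_mono[of "Suc j" J 1 R] by (simp del: of_nat_mult of_nat_Suc)
        then have "real (Suc j) * dt \<le> T"
          using mult_right_mono[of "real (Suc j)" "real (J * R)" dt] dt0 JRdt by linarith
        then have "2 * C * (real (Suc j) * dt) \<le> 2 * C * T"
          using C by (intro mult_left_mono) auto
        then show ?thesis
          by (simp add: q_def algebra_simps)
      qed
      finally show "(1 + 2 * q) ^ Suc j - 1 \<le> exp (2 * C * T)"
        by simp
    qed (use dt0 in simp)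
    finally have "L * \<bar>e 0 (j * R + r)\<bar> \<le> L * (exp (2 * C * T) * dt ^ D)"
      using L by (rule mult_left_mono)
    moreover have "\<bar>e k (j * R + r)\<bar> \<le> L * \<bar>e 0 (j * R + r)\<bar>"
      using k r j by (intro e_lip le) auto
    ultimately show ?thesis
      unfolding e_def by (simp add: mult.assoc)
  qed
  then show ?thesis
    unfolding \<Phi>_def D_def using C
    by (intro exI[of _ "min 1 (1 / (2 * C))"] exI[of _ "L * exp (2 * C * T)"] conjI) auto
qed

end
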